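(* Let $P:\mathbb R_+\times C_+\to C_+$ be a map such that for every vector $r\in\mathrm{Int}(\mathbb R^N_+)$ the restriction $P|_{\mathbb R_+\times C_r}$ is continuous, and let $c\in\mathbb R$. Assume that $Q_t:=T_{-ct}\circ P[t,\cdot]$ is a continuous-time semiflow on $C_+$ such that each $Q_t$ satisfies (A1) and (A2), and that for some $t_0>0$ the map $Q:=Q_{t_0}$ satisfies (A3) and (A4), with associated limit maps $Q_\pm$ and $r^*\in\mathrm{Int}(Y_+)$, where: $Q_-$ satisfies (UAA); $Q_+$ satisfies (UC) with constants $c_\pm^*$; either $Q$ is subhomogeneous on $[0,r^*]_C$ and satisfies (SP), or $Q$ satisfies (ASH-UC-SP) (in which case $c_\pm^*=\lim_{l\to\infty}c_{\pm l}^*$); $\{Q^n[r^*]:n\in\mathbb N\}$ is precompact in $C$; in case $c_+^*\le0$, $\{(T_{x_0}\circ Q)^n[r^*]:n\in\mathbb N\}$ is precompact in $C$ for some $x_0\in(-c_+^*,c_-^* )$; and $Q_t[r^*]\le r^*$ for all $t\in\mathbb R_+$. If $c_-^*>0$, then $\{P[t,\cdot]\}_{t\in\mathbb R_+}$ has a travelling wave $W$ connecting $0$ to $r^*$: a bounded nonconstant continuous function $W:M\times\mathbb R\to\mathbb R_+^N$ with $P[t,W](\theta,x)=W(\theta,x-ct)$ for all $(\theta,x)\in M\times\mathbb R$ and $t\in\mathbb R_+$, $W(\cdot,-\infty)=0$ and $W(\cdot,\infty)=r^*$.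
   Context: Spaces. Fix $N\ge1$ and a compact topological space $M$. $X$ is the space of bounded continuous functions $\mathbb R\to\mathbb R^N$ with norm $\|\phi\|_X=\sum_{n\ge1}2^{-n}\sup_{|x|\le n}\|\phi(x)\|_{\mathbb R^N}$. $C=C(M,X)$ with norm $\sup_{\theta\in M}\|\varphi(\theta)\|_X$; elements of $C$ are identified with bounded continuous functions $\varphi(\theta,x)$ from $M\times\mathbb R$ to $\mathbb R^N$. $C_+=\{\varphi\in C:\varphi(\theta,x)\in\mathbb R_+^N\ \forall(\theta,x)\}$. $Y=C(M,\mathbb R^N)$ with sup norm, $Y_+=C(M,\mathbb R^N_+)$, $\mathrm{Int}(Y_+)=\{\beta\in Y:\beta(\theta)\in \mathrm{Int}(\mathbb R^N_+)\ \forall\theta\}$. Vectors of $\mathbb R^N$ and elements of $Y$ are identified with the elements of $C$ that are constant in the remaining variables. Order relations $\le$ and suprema of $\mathbb R^N$-valued quantities are pointwise and componentwise. For $\psi\in C_+$, $C_\psi=[0,\psi]_C=\{\varphi\in C:0\le\varphi\le\psi\}$. $T_y[\varphi](\theta,x)=\varphi(\theta,x-y)$ for $y\in\mathbb R$. $W(\cdot,\pm\infty)=\lim_{s\to\pm\infty}W(\cdot,s)$ in $Y$. Continuous-time semiflow on $C_+$: a map $Q:\mathbb R_+\times C_+\to C_+$, $Q_t=Q(t,\cdot)$, such that for every vector $r\in\mathrm{Int}(\mathbb R^N_+)$ the restriction to $\mathbb R_+\times C_r$ is continuous, $Q_0=\mathrm{Id}$, and $Q_t\circ Q_s=Q_{t+s}$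 for all $t,s\ge0$. Conditions on a map $Q:C_+\to C_+$: (A1) $T_{-y}\circ Q[\varphi]\ge Q\circ T_{-y}[\varphi]$ for all $\varphi\in C_+$, $y\ge0$. (A2) For every vector $r\in\mathrm{Int}(\mathbb R_+^N)$, $Q|_{C_r}:C_r\to C_+$ is continuous, and monotone: $Q[\phi]\le Q[\psi]$ whenever $\phi\le\psi$ in $C_r$. By (A1), $T_{-y}\circ Q\circ T_y[\varphi](\theta,x)$ is nondecreasing in $y$; define $Q_\pm:C_+\to L^\infty(M\times\mathbb R,\mathbb R^N)$ by $Q_\pm[\varphi](\theta,x)=\lim_{y\to\pm\infty}T_{-y}\circ Q\circ T_y[\varphi](\theta,x)$. (A3) For all $\varphi\in C_+$, $n\in\mathbb N$: $T_{-y}\circ Q^n\circ T_y[\varphi]\to Q_\pm^n[\varphi]$ in $C$ as $y\to\pm\infty$. (A4) For every vector $r\in\mathrm{Int}(\mathbb R^N_+)$, $Q_\pm|_{C_r}:C_r\to C_+$ is continuous, $Q_+[0]=0$, and $Q_+[r^*]=r^*$ for some $r^*\in\mathrm{Int}(Y_+)$ (fixed). Properties: (SP) There is $N^*>0$ such that $Q^n[\varphi](\theta,x)\in\mathrm{Int}(\mathbb R^N_+)$ for all $n\ge N^*$, $(\theta,x)\in M\times(0,\infty)$, $\varphi\in C_+\setminus\{0\}$. (UC) There are $c_-^*,c_+^*\in\mathbb R$ with $c_+^*+c_-^*>0$ and $\lim_{n\to\infty}\max_{x\in n[-c_-^*+\varepsilon,\,c_+^*-\varepsilon]}\|Q_+^n[\varphi](\cdot,x)-r^*\|_Y=0$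 for all $\varepsilon\in(0,\frac{c_+^*+c_-^*}{2})$ and $\varphi\in C_+\setminus\{0\}$. (UAA) $\lim_{n\to\infty}\sup_{(\theta,x)\in M\times\mathbb R}Q_-^n[\varphi](\theta,x)=0$ for all $\varphi\in C_+$. Subhomogeneity: $Q$ is subhomogeneous on $[0,r^*]_C$ if $Q[\kappa\phi]\ge\kappa Q[\phi]$ for all $\kappa\in[0,1]$, $\phi\in[0,r^*]_C$. (ASH-UC-SP) There are sequences $\{c_{\pm l}^*\}_{l\ge1}$ in $\mathbb R$, $\{r_l^*\}_{l\ge1}$ in $\mathrm{Int}(Y_+)$ and maps $Q_l:C_+\to C_+$ (an auxiliary sequence, not the semiflow at time $l$) such that for every $l\geq 1$: (i) $Q_l$ satisfies (A1) and (A2), $Q_l[0]=0$, and $Q\ge Q_l$ on $C_{r^*}$; (ii) $T_{-y}\circ Q_l\circ T_y[\varphi]\to Q_l^+[\varphi]$ in $C$ as $y\to\infty$ for all $\varphi\in C_+$, where $Q_l^+[r_l^*]=r_l^*\le r^*$; (iii) $Q_l$ is subhomogeneous on $[0,r_l^*]_C$; (iv) $Q_l$ satisfies (SP), and $Q_l^+$ satisfies (UC) with $c_{-l}^*,c_{+l}^*,r_l^*$ in place of $c_-^*,c_+^*,r^*$. *)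

theory Defs
  imports "HOL-Analysis.Analysis"
begin

section \<open>The spaces \<open>X\<close>, \<open>C\<close> and \<open>Y\<close>\<close>

text \<open>
  The type \<open>('m, 'n) phase\<close> is the space \<open>C = C(M, X)\<close>, with \<open>M\<close> the type \<open>'m\<close> (assumed compact
  where this matters) and \<open>N = CARD('n)\<close>, seen as the space of bounded continuous functions
  from \<open>M \<times> \<real>\<close> to \<open>\<real>\<^sup>N\<close>. It is a copy of the library's bounded continuous functions because its
  norm is \<^emph>\<open>not\<close> the supremum norm: on order intervals it induces locally uniform convergence in \<open>x\<close>.
\<close>

typedef (overloaded) ('m, 'n) phase =
  "bcontfun :: ('m::topological_space \<times> real \<Rightarrow> real ^ 'n::finite) set"
  morphisms apply_phase Phase
  using const_bcontfun by blast

declare [[coercion "apply_phase :: ('m::topological_space, 'n::finite) phase \<Rightarrow> 'm \<times> real \<Rightarrow> real ^ 'n"]]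

setup_lifting type_definition_phase
setup_lifting type_definition_bcontfun

definition normX :: "(real \<Rightarrow> real ^ 'n::finite) \<Rightarrow> real" where
  "normX f = (\<Sum>k. (1 / 2) ^ Suc k * (SUP x\<in>{- real (Suc k)..real (Suc k)}. norm (f x)))"

lemma phase_eqI: "(\<And>p. apply_phase f p = apply_phase g p) \<Longrightarrow> f = g"
  by transfer auto

lemma phase_bounded: "\<exists>B. \<forall>p. norm (apply_phase f p) \<le> B"
  using apply_phase[of f] by (auto simp: bcontfun_def bounded_iff)

lemma continuous_on_apply_phase: "continuous_on S (apply_phase f)"
  using apply_phase[of f] by (auto simp: bcontfun_def intro: continuous_on_subset)

lemma normX_terms:
  assumes "\<And>x. norm (f x) \<le> B"
  shows "0 \<le> (SUP x\<in>{- real (Suc k)..real (Suc k)}. norm (f x))"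
    and "(SUP x\<in>{- real (Suc k)..real (Suc k)}. norm (f x)) \<le> B"
    and "\<bar>x\<bar> \<le> real (Suc k) \<Longrightarrow> norm (f x) \<le> (SUP x\<in>{- real (Suc k)..real (Suc k)}. norm (f x))"
    and "summable (\<lambda>k. (1 / 2) ^ Suc k * (SUP x\<in>{- real (Suc k)..real (Suc k)}. norm (f x)))"
    and "(1 / 2) ^ Suc k * (SUP x\<in>{- real (Suc k)..real (Suc k)}. norm (f x)) \<le> normX f"
    and "0 \<le> normX f" and "normX f \<le> B"
proof -
  let ?s = "\<lambda>k. SUP x\<in>{- real (Suc k)..real (Suc k)}. norm (f x)"
  have bdd: "bdd_above ((\<lambda>x. norm (f x)) ` S)" for S
    using assms by (auto intro!: bdd_aboveI)
  show upper: "\<bar>x\<bar> \<le> real (Suc k) \<Longrightarrow> norm (f x) \<le> ?s k" for x k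
    by (rule cSUP_upper[OF _ bdd]) auto
  have nonneg: "0 \<le> ?s k" for k
    using upper[of 0 k] norm_ge_zero[of "f 0"] by (auto intro: order_trans simp del: norm_ge_zero)
  then show "0 \<le> ?s k" .
  have le: "?s k \<le> B" for k
    by (rule cSUP_least) (use assms in auto)
  then show "?s k \<le> B" .
  have geo: "(\<lambda>k. (1 / 2) ^ Suc k * B) sums B"
    using sums_mult2[OF power_half_series, of B] by simp
  show summ: "summable (\<lambda>k. (1 / 2) ^ Suc k * ?s k)"
  proof (rule summable_comparison_test'[OF sums_summable[OF geo], of 0])
    fix k
    show "norm ((1 / 2) ^ Suc k * ?s k) \<le> (1 / 2) ^ Suc k * B"
      using nonneg[of k] le[of k] by (simp add: abs_mult del: of_nat_Suc)
  qed
  have "sum (\<lambda>k. (1 / 2) ^ Suc k * ?s k) {k} \<le> normX f"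
    unfolding normX_def by (rule sum_le_suminf[OF summ]) (use nonneg in \<open>auto simp del: of_nat_Suc\<close>)
  then show "(1 / 2) ^ Suc k * ?s k \<le> normX f" by simp
  show "0 \<le> normX f"
    unfolding normX_def by (rule suminf_nonneg[OF summ]) (use nonneg in \<open>auto simp del: of_nat_Suc\<close>)
  have "normX f \<le> (\<Sum>k. (1 / 2) ^ Suc k * B)"
    unfolding normX_def
    by (rule suminf_le[OF _ summ sums_summable[OF geo]]) (use le in \<open>auto simp del: of_nat_Suc\<close>)
  then show "normX f \<le> B" using sums_unique[OF geo] by simp
qed

lemma normX_triangle:
  assumes f: "\<And>x. norm (f x) \<le> A" and g: "\<And>x. norm (g x) \<le> B"
  shows "normX (\<lambda>x. f x + g x) \<le> normX f + normX g"
proof -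
  have fg: "norm (f x + g x) \<le> A + B" for x
    using norm_triangle_ineq[of "f x" "g x"] f[of x] g[of x] by linarith
  have "(SUP x\<in>{- real (Suc k)..real (Suc k)}. norm (f x + g x))
      \<le> (SUP x\<in>{- real (Suc k)..real (Suc k)}. norm (f x))
       + (SUP x\<in>{- real (Suc k)..real (Suc k)}. norm (g x))" for k
  proof (rule cSUP_least)
    fix x assume "x \<in> {- real (Suc k)..real (Suc k)}"
    then have x: "\<bar>x\<bar> \<le> real (Suc k)" by auto
    show "norm (f x + g x) \<le> (SUP x\<in>{- real (Suc k)..real (Suc k)}. norm (f x))
       + (SUP x\<in>{- real (Suc k)..real (Suc k)}. norm (g x))"
      using norm_triangle_ineq[of "f x" "g x"]
        normX_terms(3)[of f A x k, OF f x] normX_terms(3)[of g B x k, OF g x] by linarith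
  qed auto
  then have "normX (\<lambda>x. f x + g x)
      \<le> (\<Sum>k. (1 / 2) ^ Suc k * (SUP x\<in>{- real (Suc k)..real (Suc k)}. norm (f x))
            + (1 / 2) ^ Suc k * (SUP x\<in>{- real (Suc k)..real (Suc k)}. norm (g x)))"
    unfolding normX_def
    by (intro suminf_le summable_add normX_terms(4)[of _ A] normX_terms(4)[of _ B]
        normX_terms(4)[of _ "A + B"] f g fg)
       (simp add: distrib_left[symmetric] del: of_nat_Suc power_Suc)
  also have "\<dots> = normX f + normX g"
    unfolding normX_def
    by (intro suminf_add[symmetric] normX_terms(4)[of _ A] normX_terms(4)[of _ B] f g)
  finally show ?thesis .
qed

lemma normX_scale_le:
  assumes f: "\<And>x. norm (f x) \<le> B"
  shows "normX (\<lambda>x. a *\<^sub>R f x) \<le> \<bar>a\<bar> * normX f"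
proof -
  have af: "norm (a *\<^sub>R f x) \<le> \<bar>a\<bar> * B" for x
    using f[of x] by (simp add: mult_left_mono)
  have le: "(SUP x\<in>{- real (Suc k)..real (Suc k)}. norm (a *\<^sub>R f x))
      \<le> \<bar>a\<bar> * (SUP x\<in>{- real (Suc k)..real (Suc k)}. norm (f x))" for k
  proof (rule cSUP_least)
    fix x assume "x \<in> {- real (Suc k)..real (Suc k)}"
    then have x: "\<bar>x\<bar> \<le> real (Suc k)" by auto
    show "norm (a *\<^sub>R f x) \<le> \<bar>a\<bar> * (SUP x\<in>{- real (Suc k)..real (Suc k)}. norm (f x))"
      using normX_terms(3)[of f B x k, OF f x] by (simp add: mult_left_mono del: of_nat_Suc)
  qed auto
  have summ: "summable (\<lambda>k. (1 / 2) ^ Suc k * (SUP x\<in>{- real (Suc k)..real (Suc k)}. norm (f x)))"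
    by (rule normX_terms(4)[of f B]) (rule f)
  have "normX (\<lambda>x. a *\<^sub>R f x)
      \<le> (\<Sum>k. \<bar>a\<bar> * ((1 / 2) ^ Suc k * (SUP x\<in>{- real (Suc k)..real (Suc k)}. norm (f x))))"
    unfolding normX_def
  proof (rule suminf_le[OF _ normX_terms(4)[of _ "\<bar>a\<bar> * B", OF af] summable_mult[OF summ]])
    fix k
    show "(1 / 2) ^ Suc k * (SUP x\<in>{- real (Suc k)..real (Suc k)}. norm (a *\<^sub>R f x))
      \<le> \<bar>a\<bar> * ((1 / 2) ^ Suc k * (SUP x\<in>{- real (Suc k)..real (Suc k)}. norm (f x)))"
      using mult_left_mono[OF le[of k], of "(1 / 2) ^ Suc k"] by (simp only: mult.left_commute) simp
  qed
  also have "\<dots> = \<bar>a\<bar> * normX f"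
    unfolding normX_def by (rule suminf_mult[OF summ])
  finally show ?thesis .
qed

instantiation phase :: (topological_space, finite) real_vector
begin

lift_definition zero_phase :: "('a, 'b) phase" is "\<lambda>_. 0"
  by (rule const_bcontfun)

lift_definition plus_phase :: "('a, 'b) phase \<Rightarrow> ('a, 'b) phase \<Rightarrow> ('a, 'b) phase"
  is "\<lambda>f g p. f p + g p" by (rule plus_cont)

lift_definition minus_phase :: "('a, 'b) phase \<Rightarrow> ('a, 'b) phase \<Rightarrow> ('a, 'b) phase"
  is "\<lambda>f g p. f p - g p" by (rule minus_cont)

lift_definition uminus_phase :: "('a, 'b) phase \<Rightarrow> ('a, 'b) phase"
  is "\<lambda>f p. - f p" by (rule uminus_cont)

lift_definition scaleR_phase :: "real \<Rightarrow> ('a, 'b) phase \<Rightarrow> ('a, 'b) phase"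
  is "\<lambda>r f p. r *\<^sub>R f p" by (rule scaleR_cont)

instance
  by standard (transfer; simp add: algebra_simps fun_eq_iff)+

end

lemmas phase_apply_simps [simp] =
  zero_phase.rep_eq plus_phase.rep_eq minus_phase.rep_eq uminus_phase.rep_eq scaleR_phase.rep_eq

instantiation phase :: (topological_space, finite) real_normed_vector
begin

definition norm_phase :: "('a, 'b) phase \<Rightarrow> real" where
  "norm_phase f = (SUP \<theta>. normX (\<lambda>x. f (\<theta>, x)))"

definition dist_phase :: "('a, 'b) phase \<Rightarrow> ('a, 'b) phase \<Rightarrow> real" where
  "dist_phase f g = norm (f - g)"

definition sgn_phase :: "('a, 'b) phase \<Rightarrow> ('a, 'b) phase" where
  "sgn_phase f = f /\<^sub>R norm f"

definition uniformity_phase :: "(('a, 'b) phase \<times> ('a, 'b) phase) filter" where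
  "uniformity_phase = (INF e\<in>{0 <..}. principal {(f, g). dist f g < e})"

definition open_phase :: "('a, 'b) phase set \<Rightarrow> bool" where
  "open_phase S = (\<forall>f\<in>S. \<forall>\<^sub>F (f', g) in uniformity. f' = f \<longrightarrow> g \<in> S)"

lemma normX_le_norm_phase:
  fixes f :: "('a, 'b) phase"
  shows "normX (\<lambda>x. f (\<theta>, x)) \<le> norm f"
proof -
  obtain B where B: "\<And>p. norm (f p) \<le> B" using phase_bounded[of f] by blast
  have "bdd_above (range (\<lambda>\<theta>. normX (\<lambda>x. f (\<theta>, x))))"
    by (rule bdd_aboveI[of _ B]) (auto intro: normX_terms(7) B)
  then show ?thesis unfolding norm_phase_def by (rule cSUP_upper[OF UNIV_I])
qed

lemma norm_phase_least:
  fixes f :: "('a, 'b) phase"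
  assumes "\<And>\<theta>. normX (\<lambda>x. f (\<theta>, x)) \<le> b" shows "norm f \<le> b"
  unfolding norm_phase_def by (rule cSUP_least) (use assms in auto)

lemma norm_phase_scale_le: "norm (a *\<^sub>R f) \<le> \<bar>a\<bar> * norm (f :: ('a, 'b) phase)"
proof (rule norm_phase_least)
  fix \<theta>
  obtain B where B: "\<And>p. norm (f p) \<le> B" using phase_bounded[of f] by blast
  have "normX (\<lambda>x. a *\<^sub>R f (\<theta>, x)) \<le> \<bar>a\<bar> * normX (\<lambda>x. f (\<theta>, x))"
    by (rule normX_scale_le) (rule B)
  also have "\<dots> \<le> \<bar>a\<bar> * norm f"
    by (rule mult_left_mono[OF normX_le_norm_phase]) simp
  finally show "normX (\<lambda>x. (a *\<^sub>R f) (\<theta>, x)) \<le> \<bar>a\<bar> * norm f" by simp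
qed

lemma norm_apply_phase_le:
  fixes f :: "('a, 'b) phase"
  assumes x: "\<bar>x\<bar> \<le> real (Suc k)"
  shows "norm (f (\<theta>, x)) \<le> 2 ^ Suc k * norm f"
proof -
  obtain B where B: "\<And>p. norm (f p) \<le> B" using phase_bounded[of f] by blast
  let ?s = "SUP x\<in>{- real (Suc k)..real (Suc k)}. norm (f (\<theta>, x))"
  have "norm (f (\<theta>, x)) \<le> ?s" by (rule normX_terms(3)[OF _ x]) (rule B)
  also have "?s = 2 ^ Suc k * ((1 / 2) ^ Suc k * ?s)"
    by (simp add: power_divide del: power_Suc of_nat_Suc)
  also have "(1 / 2) ^ Suc k * ?s \<le> normX (\<lambda>x. f (\<theta>, x))" by (rule normX_terms(5)) (rule B)
  also have "\<dots> \<le> norm f" by (rule normX_le_norm_phase)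
  finally show ?thesis by (simp del: power_Suc)
qed

instance
proof
  fix f g :: "('a, 'b) phase" and a :: real
  show "norm f = 0 \<longleftrightarrow> f = 0"
  proof
    assume 0: "norm f = 0"
    show "f = 0"
    proof (rule phase_eqI)
      fix p :: "'a \<times> real"
      obtain \<theta> x where p: "p = (\<theta>, x)" by force
      obtain k where "\<bar>x\<bar> \<le> real (Suc k)"
        by (metis le_SucI of_nat_le_iff order_trans real_arch_simple order_refl)
      from norm_apply_phase_le[OF this, of f \<theta>] show "f p = (0 :: ('a, 'b) phase) p"
        using 0 by (simp add: p)
    qed
  next
    assume "f = 0"
    then show "norm f = 0" by (simp add: norm_phase_def normX_def)
  qed
  show "norm (f + g) \<le> norm f + norm g"
  proof (rule norm_phase_least)
    fix \<theta>
    obtain A B where A: "\<And>p. norm (f p) \<le> A" and B: "\<And>p. norm (g p) \<le> B"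
      using phase_bounded[of f] phase_bounded[of g] by blast
    have "normX (\<lambda>x. f (\<theta>, x) + g (\<theta>, x)) \<le> normX (\<lambda>x. f (\<theta>, x)) + normX (\<lambda>x. g (\<theta>, x))"
      by (rule normX_triangle[of _ A _ B]) (rule A B)+
    also have "\<dots> \<le> norm f + norm g" by (intro add_mono normX_le_norm_phase)
    finally show "normX (\<lambda>x. (f + g) (\<theta>, x)) \<le> norm f + norm g" by simp
  qed
  show "norm (a *\<^sub>R f) = \<bar>a\<bar> * norm f"
  proof (cases "a = 0")
    case True
    then show ?thesis by (simp add: norm_phase_def normX_def)
  next
    case False
    have "norm f = norm (inverse a *\<^sub>R (a *\<^sub>R f))" using False by simp
    also have "\<dots> \<le> \<bar>inverse a\<bar> * norm (a *\<^sub>R f)" by (rule norm_phase_scale_le)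
    finally have "\<bar>a\<bar> * norm f \<le> \<bar>a\<bar> * (\<bar>inverse a\<bar> * norm (a *\<^sub>R f))"
      by (rule mult_left_mono) simp
    also have "\<dots> = norm (a *\<^sub>R f)" using False by (simp add: field_simps)
    finally show ?thesis using norm_phase_scale_le[of a f] by (rule antisym[rotated])
  qed
qed (rule dist_phase_def sgn_phase_def uniformity_phase_def open_phase_def)+

end

instantiation phase :: (topological_space, finite) order
begin

definition less_eq_phase :: "('a, 'b) phase \<Rightarrow> ('a, 'b) phase \<Rightarrow> bool" where
  "less_eq_phase f g \<longleftrightarrow> (\<forall>p. apply_phase f p \<le> apply_phase g p)"

definition less_phase :: "('a, 'b) phase \<Rightarrow> ('a, 'b) phase \<Rightarrow> bool" where
  "less_phase f g \<longleftrightarrow> f \<le> g \<and> f \<noteq> g"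

instance
proof
  fix f g h :: "('a, 'b) phase"
  show "f < g \<longleftrightarrow> f \<le> g \<and> \<not> g \<le> f"
    unfolding less_phase_def less_eq_phase_def by (metis antisym order_refl phase_eqI)
  show "f \<le> f" by (simp add: less_eq_phase_def)
  show "f \<le> g \<Longrightarrow> g \<le> h \<Longrightarrow> f \<le> h"
    unfolding less_eq_phase_def by (metis order_trans)
  show "f \<le> g \<Longrightarrow> g \<le> f \<Longrightarrow> f = g"
    unfolding less_eq_phase_def by (metis antisym phase_eqI)
qed

end

definition Cplus :: "('m::topological_space, 'n::finite) phase set" where
  "Cplus = {\<phi>. 0 \<le> \<phi>}"

text \<open>
  The space \<open>Y = C(M, \<real>\<^sup>N)\<close> is the library's type of bounded continuous functions with the
  supremum norm; boundedness is automatic for compact \<open>M\<close>.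
\<close>

definition int_orthant :: "(real ^ 'n::finite) set" where
  "int_orthant = interior {v. 0 \<le> v}"

lemma int_orthant_iff:
  fixes v :: "real ^ 'n::finite"
  shows "v \<in> int_orthant \<longleftrightarrow> (\<forall>i. 0 < v $ i)"
proof
  assume v: "v \<in> int_orthant"
  show "\<forall>i. 0 < v $ i"
  proof
    fix i
    have "int_orthant \<subseteq> interior {w :: real ^ 'n. w $ i \<ge> 0}"
      unfolding int_orthant_def by (rule interior_mono) (auto simp: less_eq_vec_def)
    then show "0 < v $ i" using v by auto
  qed
next
  assume v: "\<forall>i. 0 < v $ i"
  have "open {v :: real ^ 'n. \<forall>i. 0 < v $ i}"
    by (simp add: Collect_all_eq open_INT open_Collect_less continuous_intros)
  then have "{v :: real ^ 'n. \<forall>i. 0 < v $ i} \<subseteq> int_orthant"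
    unfolding int_orthant_def
    by (intro interior_maximal) (auto simp: less_eq_vec_def less_imp_le)
  with v show "v \<in> int_orthant" by blast
qed

definition IntYplus :: "('m::topological_space \<Rightarrow>\<^sub>C (real ^ 'n::finite)) set" where
  "IntYplus = {\<beta>. \<forall>\<theta>. apply_bcontfun \<beta> \<theta> \<in> int_orthant}"

text \<open>The identifications of elements of \<open>Y\<close> and of vectors with elements of \<open>C\<close>.\<close>

lift_definition of_Y :: "('m::topological_space \<Rightarrow>\<^sub>C (real ^ 'n::finite)) \<Rightarrow> ('m, 'n) phase"
  is "\<lambda>\<beta> p. \<beta> (fst p)"
proof -
  fix \<beta> :: "'m \<Rightarrow> real ^ 'n" assume "\<beta> \<in> bcontfun"
  then have "continuous_on UNIV \<beta>" and "bounded (range \<beta>)" by (auto simp: bcontfun_def)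
  then show "(\<lambda>p :: 'm \<times> real. \<beta> (fst p)) \<in> bcontfun"
    unfolding bcontfun_def
    by (auto intro: bounded_subset continuous_on_compose2[OF _ continuous_on_fst[OF continuous_on_id]])
qed

definition of_vec :: "real ^ 'n::finite \<Rightarrow> ('m::topological_space, 'n) phase" where
  "of_vec v = of_Y (const_bcontfun v)"

text \<open>The section \<open>\<phi>(\<cdot>, x) \<in> Y\<close>.\<close>

lift_definition slice :: "('m::topological_space, 'n::finite) phase \<Rightarrow> real \<Rightarrow> ('m \<Rightarrow>\<^sub>C (real ^ 'n))"
  is "\<lambda>\<phi> x \<theta>. \<phi> (\<theta>, x)"
proof -
  fix \<phi> :: "'m \<times> real \<Rightarrow> real ^ 'n" and x assume "\<phi> \<in> bcontfun"
  then have c: "continuous_on UNIV \<phi>" and "bounded (range \<phi>)" by (auto simp: bcontfun_def)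
  then have "bounded (range (\<lambda>\<theta>. \<phi> (\<theta>, x)))" by (auto intro: bounded_subset)
  moreover have "continuous_on UNIV (\<lambda>\<theta>. (\<theta>, x))"
    by (intro continuous_on_Pair continuous_on_id continuous_on_const)
  ultimately show "(\<lambda>\<theta>. \<phi> (\<theta>, x)) \<in> bcontfun"
    unfolding bcontfun_def using continuous_on_compose2[OF c] by auto
qed

text \<open>The translation \<open>T\<^sub>y\<close>.\<close>

lift_definition shift :: "real \<Rightarrow> ('m::topological_space, 'n::finite) phase \<Rightarrow> ('m, 'n) phase"
  is "\<lambda>y \<phi> (\<theta>, x). \<phi> (\<theta>, x - y)"
proof -
  fix \<phi> :: "'m \<times> real \<Rightarrow> real ^ 'n" and y assume "\<phi> \<in> bcontfun"
  then have c: "continuous_on UNIV \<phi>" and "bounded (range \<phi>)" by (auto simp: bcontfun_def)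
  then have "bounded (range (\<lambda>p. \<phi> (fst p, snd p - y)))" by (auto intro: bounded_subset)
  moreover have "continuous_on UNIV (\<lambda>p :: 'm \<times> real. (fst p, snd p - y))"
    by (intro continuous_on_Pair continuous_on_diff continuous_on_fst continuous_on_snd
        continuous_on_id continuous_on_const)
  ultimately show "(\<lambda>(\<theta>, x). \<phi> (\<theta>, x - y)) \<in> bcontfun"
    unfolding bcontfun_def case_prod_unfold using continuous_on_compose2[OF c] by auto
qed

lemmas phase_embedding_simps [simp] = of_Y.rep_eq slice.rep_eq

lemma apply_shift [simp]: "shift y \<phi> (\<theta>, x) = \<phi> (\<theta>, x - y)"
  by transfer simp

lemma apply_of_vec [simp]: "of_vec v p = v"
  by (simp add: of_vec_def const_bcontfun.rep_eq)


section \<open>Conditions on maps\<close>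

text \<open>
  A map \<open>Q : C\<^sub>+ \<rightarrow> C\<^sub>+\<close> is a function on the whole type whose values outside \<open>C\<^sub>+\<close> are irrelevant.
  For \<open>\<psi> \<in> C\<^sub>+\<close>, \<open>C\<^sub>\<psi>\<close> is the order interval \<open>{0..\<psi>}\<close>.
\<close>

definition self_map :: "(('m::topological_space, 'n::finite) phase \<Rightarrow> ('m, 'n) phase) \<Rightarrow> bool" where
  "self_map Q \<longleftrightarrow> (\<forall>\<phi>\<in>Cplus. Q \<phi> \<in> Cplus)"

definition continuous_family ::
  "(real \<Rightarrow> ('m::topological_space, 'n::finite) phase \<Rightarrow> ('m, 'n) phase) \<Rightarrow> bool" where
  "continuous_family P \<longleftrightarrow>
     (\<forall>t\<ge>0. self_map (P t)) \<and>
     (\<forall>r\<in>int_orthant. continuous_on ({0..} \<times> {0..of_vec r}) (\<lambda>(t, \<phi>). P t \<phi>))"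

definition semiflow ::
  "(real \<Rightarrow> ('m::topological_space, 'n::finite) phase \<Rightarrow> ('m, 'n) phase) \<Rightarrow> bool" where
  "semiflow Q \<longleftrightarrow>
     continuous_family Q \<and>
     (\<forall>\<phi>\<in>Cplus. Q 0 \<phi> = \<phi>) \<and>
     (\<forall>t\<ge>0. \<forall>s\<ge>0. \<forall>\<phi>\<in>Cplus. Q t (Q s \<phi>) = Q (t + s) \<phi>)"

definition A1 :: "(('m::topological_space, 'n::finite) phase \<Rightarrow> ('m, 'n) phase) \<Rightarrow> bool" where
  "A1 Q \<longleftrightarrow> (\<forall>\<phi>\<in>Cplus. \<forall>y\<ge>0. Q (shift (- y) \<phi>) \<le> shift (- y) (Q \<phi>))"

definition A2 :: "(('m::topological_space, 'n::finite) phase \<Rightarrow> ('m, 'n) phase) \<Rightarrow> bool" where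
  "A2 Q \<longleftrightarrow> (\<forall>r\<in>int_orthant.
     continuous_on {0..of_vec r} Q \<and>
     (\<forall>\<phi>\<in>{0..of_vec r}. \<forall>\<psi>\<in>{0..of_vec r}. \<phi> \<le> \<psi> \<longrightarrow> Q \<phi> \<le> Q \<psi>))"

text \<open>
  The limit maps: \<open>Q\<^sub>+\<close> is \<open>limit_map at_top Q\<close> and \<open>Q\<^sub>-\<close> is \<open>limit_map at_bot Q\<close>. They are defined
  by pointwise limits, and a priori \<open>limit_fun F Q \<phi>\<close> need not be continuous, in which case
  \<open>limit_map F Q \<phi>\<close> is meaningless. Wherever limit maps occur below, however, convergence in \<open>C\<close>
  to \<open>limit_map F Q \<phi>\<close> for all \<open>\<phi> \<in> C\<^sub>+\<close> is also required, which forces \<open>limit_map F Q \<phi>\<close> to be the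
  pointwise limit function (see \<open>limit_map_eq_limit_fun\<close>).
\<close>

definition limit_fun ::
  "real filter \<Rightarrow> (('m::topological_space, 'n::finite) phase \<Rightarrow> ('m, 'n) phase) \<Rightarrow>
   ('m, 'n) phase \<Rightarrow> 'm \<times> real \<Rightarrow> real ^ 'n" where
  "limit_fun F Q \<phi> p = Lim F (\<lambda>y. shift (- y) (Q (shift y \<phi>)) p)"

definition limit_map ::
  "real filter \<Rightarrow> (('m::topological_space, 'n::finite) phase \<Rightarrow> ('m, 'n) phase) \<Rightarrow>
   ('m, 'n) phase \<Rightarrow> ('m, 'n) phase" where
  "limit_map F Q \<phi> = Phase (limit_fun F Q \<phi>)"

lemma tendsto_apply_phase:
  fixes f :: "'i \<Rightarrow> ('m::topological_space, 'n::finite) phase"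
  assumes "(f \<longlongrightarrow> g) F" shows "((\<lambda>i. f i p) \<longlongrightarrow> g p) F"
proof -
  obtain \<theta> x where p: "p = (\<theta>, x)" by force
  obtain m :: nat where "\<bar>x\<bar> \<le> real m" using real_arch_simple by blast
  then obtain k where k: "\<bar>x\<bar> \<le> real (Suc k)" using that[of m] by simp
  have lim: "((\<lambda>i. 2 ^ Suc k * norm (f i - g)) \<longlongrightarrow> 2 ^ Suc k * 0) F"
    by (rule tendsto_mult_left[OF tendsto_norm_zero[OF LIM_zero[OF assms]]])
  have "norm (f i p - g p) \<le> 2 ^ Suc k * norm (f i - g)" for i
    using norm_apply_phase_le[OF k, of "f i - g" \<theta>] by (simp add: p del: power_Suc)
  then have "((\<lambda>i. f i p - g p) \<longlongrightarrow> 0) F"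
    using lim unfolding mult_zero_right by (rule Lim_null_comparison[OF always_eventually[OF allI]])
  then show ?thesis by (rule LIM_zero_cancel)
qed

lemma limit_map_eq_limit_fun:
  assumes "((\<lambda>y. shift (- y) (Q (shift y \<phi>))) \<longlongrightarrow> \<psi>) F" and "F \<noteq> bot"
  shows "limit_map F Q \<phi> = \<psi>" and "apply_phase (limit_map F Q \<phi>) = limit_fun F Q \<phi>"
proof -
  have "limit_fun F Q \<phi> = apply_phase \<psi>"
    unfolding limit_fun_def using assms by (auto intro!: tendsto_Lim tendsto_apply_phase)
  then show "limit_map F Q \<phi> = \<psi>" "apply_phase (limit_map F Q \<phi>) = limit_fun F Q \<phi>"
    by (simp_all add: limit_map_def apply_phase_inverse)
qed

definition A3 :: "(('m::topological_space, 'n::finite) phase \<Rightarrow> ('m, 'n) phase) \<Rightarrow> bool" where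
  "A3 Q \<longleftrightarrow> (\<forall>\<phi>\<in>Cplus. \<forall>n. \<forall>F\<in>{at_top, at_bot}.
     ((\<lambda>y. shift (- y) ((Q ^^ n) (shift y \<phi>))) \<longlongrightarrow> (limit_map F Q ^^ n) \<phi>) F)"

definition A4 ::
  "(('m::topological_space, 'n::finite) phase \<Rightarrow> ('m, 'n) phase) \<Rightarrow> ('m \<Rightarrow>\<^sub>C (real ^ 'n)) \<Rightarrow> bool" where
  "A4 Q rs \<longleftrightarrow>
     (\<forall>r\<in>int_orthant. \<forall>F\<in>{at_top, at_bot}.
        continuous_on {0..of_vec r} (limit_map F Q) \<and>
        limit_map F Q ` {0..of_vec r} \<subseteq> Cplus) \<and>
     limit_map at_top Q 0 = 0 \<and>
     rs \<in> IntYplus \<and> limit_map at_top Q (of_Y rs) = of_Y rs"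

definition SP :: "(('m::topological_space, 'n::finite) phase \<Rightarrow> ('m, 'n) phase) \<Rightarrow> bool" where
  "SP Q \<longleftrightarrow> (\<exists>N>0. \<forall>n\<ge>N::nat. \<forall>\<theta>. \<forall>x>0. \<forall>\<phi>\<in>Cplus - {0}. (Q ^^ n) \<phi> (\<theta>, x) \<in> int_orthant)"

text \<open>
  The arguments \<open>cm\<close> and \<open>cp\<close> stand for \<open>c\<^sub>-\<^sup>*\<close> and \<open>c\<^sub>+\<^sup>*\<close>, and \<open>rs\<close> for \<open>r\<^sup>*\<close>.
  \<open>UC\<close> and \<open>UAA\<close> are applied directly to the limit maps.
\<close>

definition UC ::
  "(('m::topological_space, 'n::finite) phase \<Rightarrow> ('m, 'n) phase) \<Rightarrow> real \<Rightarrow> real \<Rightarrow>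
   ('m \<Rightarrow>\<^sub>C (real ^ 'n)) \<Rightarrow> bool" where
  "UC R cm cp rs \<longleftrightarrow> cp + cm > 0 \<and>
     (\<forall>\<epsilon>\<in>{0<..<(cp + cm) / 2}. \<forall>\<phi>\<in>Cplus - {0}.
        (\<lambda>n. SUP x\<in>{real n * (- cm + \<epsilon>)..real n * (cp - \<epsilon>)}. norm (slice ((R ^^ n) \<phi>) x - rs))
          \<longlonglongrightarrow> 0)"

definition UAA :: "(('m::topological_space, 'n::finite) phase \<Rightarrow> ('m, 'n) phase) \<Rightarrow> bool" where
  "UAA R \<longleftrightarrow> (\<forall>\<phi>\<in>Cplus. (\<lambda>n. \<chi> i. SUP p. (R ^^ n) \<phi> p $ i) \<longlonglongrightarrow> 0)"

definition subhomogeneous ::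
  "(('m::topological_space, 'n::finite) phase \<Rightarrow> ('m, 'n) phase) \<Rightarrow> ('m \<Rightarrow>\<^sub>C (real ^ 'n)) \<Rightarrow> bool" where
  "subhomogeneous Q rs \<longleftrightarrow>
     (\<forall>\<kappa>\<in>{0..1}. \<forall>\<phi>\<in>{0..of_Y rs}. \<kappa> *\<^sub>R Q \<phi> \<le> Q (\<kappa> *\<^sub>R \<phi>))"

text \<open>
  The limit relation between \<open>c\<^sub>\<plusminus>\<^sup>*\<close> and the sequences \<open>c\<^sub>\<plusminus>\<^sub>l\<^sup>*\<close> is part of the condition.
\<close>

definition ASH_UC_SP ::
  "(('m::topological_space, 'n::finite) phase \<Rightarrow> ('m, 'n) phase) \<Rightarrow> ('m \<Rightarrow>\<^sub>C (real ^ 'n)) \<Rightarrow>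
   real \<Rightarrow> real \<Rightarrow> bool" where
  "ASH_UC_SP Q rs cm cp \<longleftrightarrow>
     (\<exists>(cml :: nat \<Rightarrow> real) (cpl :: nat \<Rightarrow> real) (rl :: nat \<Rightarrow> 'm \<Rightarrow>\<^sub>C (real ^ 'n))
        (Ql :: nat \<Rightarrow> ('m, 'n) phase \<Rightarrow> ('m, 'n) phase).
        (\<forall>l\<ge>1.
           rl l \<in> IntYplus \<and> self_map (Ql l) \<and>
           A1 (Ql l) \<and> A2 (Ql l) \<and> Ql l 0 = 0 \<and> (\<forall>\<phi>\<in>{0..of_Y rs}. Ql l \<phi> \<le> Q \<phi>) \<and>
           (\<forall>\<phi>\<in>Cplus. ((\<lambda>y. shift (- y) (Ql l (shift y \<phi>))) \<longlongrightarrow> limit_map at_top (Ql l) \<phi>) at_top) \<and>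
           limit_map at_top (Ql l) (of_Y (rl l)) = of_Y (rl l) \<and> of_Y (rl l) \<le> of_Y rs \<and>
           subhomogeneous (Ql l) (rl l) \<and>
           SP (Ql l) \<and> UC (limit_map at_top (Ql l)) (cml l) (cpl l) (rl l)) \<and>
        cml \<longlonglongrightarrow> cm \<and> cpl \<longlonglongrightarrow> cp)"

definition precompact :: "'a::topological_space set \<Rightarrow> bool" where
  "precompact S \<longleftrightarrow> compact (closure S)"

definition travelling_wave ::
  "(real \<Rightarrow> ('m::topological_space, 'n::finite) phase \<Rightarrow> ('m, 'n) phase) \<Rightarrow> real \<Rightarrow>
   ('m \<Rightarrow>\<^sub>C (real ^ 'n)) \<Rightarrow> ('m, 'n) phase \<Rightarrow> bool" where
  "travelling_wave P c rs W \<longleftrightarrow>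
     W \<in> Cplus \<and> (\<exists>p q. W p \<noteq> W q) \<and>
     (\<forall>t\<ge>0. \<forall>\<theta> x. P t W (\<theta>, x) = W (\<theta>, x - c * t)) \<and>
     (slice W \<longlongrightarrow> 0) at_bot \<and> (slice W \<longlongrightarrow> rs) at_top"

end

theory Submission
  imports Defs
begin

text \<open>
  Since \<open>Q\<^sub>t = T\<^bsub>- c t\<^esub> \<circ> P\<^sub>t\<close>, a travelling wave is a rest point \<open>W\<close> of the semiflow \<open>Q\<^sub>t\<close> with the
  prescribed limits. The candidate is the limit of the orbit of \<open>r\<^sup>*\<close>. This orbit decreases because
  \<open>Q\<^sub>t[r\<^sup>*] \<le> r\<^sup>*\<close>, and it converges in \<open>C\<close> because the orbit of \<open>Q = Q\<^bsub>t0\<^esub>\<close> is precompact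
  (\<open>decreasing_precompact_converges\<close>). Far to the left, \<open>W \<le> Q\<^sup>n[r\<^sup>*]\<close> is compared with
  \<open>Q\<^sub>-\<^sup>n[r\<^sup>*]\<close>, which tends to \<open>0\<close>.

  What remains is the limit \<open>r\<^sup>*\<close> on the right. For this, \<open>W \<le> r\<^sup>*\<close> is bounded below by a
  barrier \<open>V \<le> r\<^sup>*\<close> with \<open>V \<le> Q V\<close> and \<open>V(\<cdot>, \<infinity>) = r\<^sup>*\<close>; by monotonicity \<open>V \<le> Q\<^sup>n[r\<^sup>*]\<close> for all \<open>n\<close>, so
  that \<open>V \<le> W\<close>.

  If \<open>c\<^sub>+\<^sup>* > 0\<close>, the origin lies strictly inside the spreading interval \<open>(- c\<^sub>-\<^sup>*, c\<^sub>+\<^sup>*)\<close> of \<open>Q\<^sub>+\<close>. A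
  small bump then spreads under \<open>Q\<^sub>+\<close> to a state near \<open>r\<^sup>*\<close> on its own support, and so it does under
  \<open>Q\<close> if it is placed far enough to the right. It is therefore a subsolution of some iterate of \<open>Q\<close>,
  it persists below the orbit of \<open>r\<^sup>*\<close>, and the limit of that orbit is nonzero
  (\<open>bump_subsolution_far_right\<close>). If \<open>c\<^sub>+\<^sup>* \<le> 0\<close>, the bump runs away to the left, and the
  translation by \<open>x0 \<in> (- c\<^sub>+\<^sup>*, c\<^sub>-\<^sup>*)\<close> compensates this: the same argument applies to
  \<open>R = T\<^bsub>x0\<^esub> \<circ> Q\<close>, since \<open>R\<^sup>n \<ge> T\<^bsub>n x0\<^esub> \<circ> Q\<^sup>n\<close> (\<open>drift_funpow_ge\<close>). The limit \<open>V\<close> of \<open>R\<^sup>n[r\<^sup>*]\<close> is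
  nondecreasing in \<open>x\<close>, so moving it back by \<open>x0 \<ge> 0\<close> increases it; thus the fixed point of \<open>R\<close> is a
  subsolution of \<open>Q\<close> (\<open>drifted_orbit_limit\<close>). Both cases are treated together, with \<open>x0 = 0\<close>
  in the first one.
\<close>

section \<open>Order, norm and convergence in the phase space\<close>

lemma norm_mono_orthant:
  fixes a b :: "real ^ 'n"
  assumes "0 \<le> a" "a \<le> b"
  shows "norm a \<le> norm b"
  by (rule norm_le_componentwise_cart)
     (use assms in \<open>auto simp: less_eq_vec_def intro: order_trans\<close>)

lemma phase_leD: "\<phi> \<le> \<psi> \<Longrightarrow> apply_phase \<phi> p \<le> apply_phase \<psi> p"
  unfolding less_eq_phase_def by blast

lemma phase_le_nthD: "\<phi> \<le> \<psi> \<Longrightarrow> apply_phase \<phi> p $ i \<le> apply_phase \<psi> p $ i"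
  using phase_leD[of \<phi> \<psi> p] by (simp add: less_eq_vec_def)

lemma phase_le_norm_mono:
  fixes f g :: "('m::topological_space, 'n::finite) phase"
  assumes "0 \<le> f" "f \<le> g"
  shows "norm f \<le> norm g"
proof (rule norm_phase_least)
  fix \<theta>
  obtain A B where A: "\<And>p. norm (f p) \<le> A" and B: "\<And>p. norm (g p) \<le> B"
    using phase_bounded[of f] phase_bounded[of g] by blast
  have fg: "norm (f p) \<le> norm (g p)" for p
    using phase_leD[OF assms(1), of p] phase_leD[OF assms(2), of p]
    by (intro norm_mono_orthant) simp_all
  have sup: "(SUP x\<in>{- real (Suc k)..real (Suc k)}. norm (f (\<theta>, x)))
      \<le> (SUP x\<in>{- real (Suc k)..real (Suc k)}. norm (g (\<theta>, x)))" for k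
  proof (rule cSUP_least)
    fix x assume "x \<in> {- real (Suc k)..real (Suc k)}"
    then have x: "\<bar>x\<bar> \<le> real (Suc k)" by auto
    show "norm (f (\<theta>, x)) \<le> (SUP x\<in>{- real (Suc k)..real (Suc k)}. norm (g (\<theta>, x)))"
      by (rule order_trans[OF fg normX_terms(3)[OF B x]])
  qed auto
  have "normX (\<lambda>x. f (\<theta>, x)) \<le> normX (\<lambda>x. g (\<theta>, x))"
    unfolding normX_def
    by (intro suminf_le mult_left_mono sup normX_terms(4)[of _ A] normX_terms(4)[of _ B] A B) simp
  also have "\<dots> \<le> norm g" by (rule normX_le_norm_phase)
  finally show "normX (\<lambda>x. f (\<theta>, x)) \<le> norm g" .
qed

lemma phase_tendsto_le:
  fixes f g :: "'i \<Rightarrow> ('m::topological_space, 'n::finite) phase"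
  assumes "F \<noteq> bot" "(f \<longlongrightarrow> a) F" "(g \<longlongrightarrow> b) F" "\<forall>\<^sub>F i in F. f i \<le> g i"
  shows "a \<le> b"
  unfolding less_eq_phase_def less_eq_vec_def
proof (intro allI)
  fix p j
  have "\<forall>\<^sub>F i in F. f i p $ j \<le> g i p $ j"
    using assms(4) by eventually_elim (rule phase_le_nthD)
  then show "a p $ j \<le> b p $ j"
    by (rule tendsto_le[OF assms(1) tendsto_vec_nth[OF tendsto_apply_phase[OF assms(3)]]
          tendsto_vec_nth[OF tendsto_apply_phase[OF assms(2)]]])
qed

text \<open>
  The weight of \<open>[- k, k]\<close> in the norm of \<open>X\<close> is \<open>2\<^sup>-\<^sup>k\<close>, so norm convergence controls each
  compact window of \<open>x\<close>, uniformly in \<open>\<theta>\<close>. All limits in \<open>y\<close> are used in this form.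
\<close>

lemma tendsto_phase_locally_uniform:
  fixes f :: "'i \<Rightarrow> ('m::topological_space, 'n::finite) phase"
  assumes "(f \<longlongrightarrow> g) F" "e > 0"
  shows "\<forall>\<^sub>F i in F. \<forall>\<theta> x. \<bar>x\<bar> \<le> K \<longrightarrow> norm (f i (\<theta>, x) - g (\<theta>, x)) < e"
proof -
  obtain k where k: "K \<le> real k" using real_arch_simple by blast
  have "\<forall>\<^sub>F i in F. dist (f i) g < e / 2 ^ Suc k"
    by (rule tendstoD[OF assms(1)]) (use assms(2) in simp)
  then show ?thesis
  proof (eventually_elim, intro allI impI)
    fix i \<theta> x assume d: "dist (f i) g < e / 2 ^ Suc k" and x: "\<bar>x\<bar> \<le> K"
    have "norm ((f i - g) (\<theta>, x)) \<le> 2 ^ Suc k * norm (f i - g)"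
      by (rule norm_apply_phase_le) (use k x in auto)
    also have "\<dots> < 2 ^ Suc k * (e / 2 ^ Suc k)"
      by (rule mult_strict_left_mono) (use d in \<open>auto simp: dist_norm\<close>)
    finally show "norm (f i (\<theta>, x) - g (\<theta>, x)) < e" by simp
  qed
qed

text \<open>
  A subsequence converges by precompactness. Its limit \<open>L\<close> lies below the whole sequence, and since
  the norm is monotone on the cone, \<open>norm (X n - L)\<close> decreases in \<open>n\<close>; so one small term of the
  subsequence makes the whole tail small.
\<close>

lemma decreasing_precompact_converges:
  fixes X :: "nat \<Rightarrow> ('m::topological_space, 'n::finite) phase"
  assumes dec: "decseq X" and pre: "precompact (range X)"
  obtains L where "X \<longlonglongrightarrow> L" "\<And>n. L \<le> X n"
proof -
  have "\<forall>n. X n \<in> closure (range X)" using closure_subset by fastforce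
  with pre obtain L r where r: "strict_mono r" and lim: "(X \<circ> r) \<longlonglongrightarrow> L"
    unfolding precompact_def compact_def by metis
  have le: "L \<le> X n" for n
  proof (rule phase_tendsto_le[OF _ lim tendsto_const])
    show "\<forall>\<^sub>F k in sequentially. (X \<circ> r) k \<le> X n"
      using eventually_ge_at_top[of n]
    proof eventually_elim
      case (elim k)
      then have "n \<le> r k" using seq_suble[OF r, of k] by simp
      then show ?case using dec by (simp add: decseq_def)
    qed
  qed simp
  have "X \<longlonglongrightarrow> L"
  proof (rule LIMSEQ_I)
    fix e :: real assume "e > 0"
    then obtain k where k: "norm (X (r k) - L) < e"
      using LIMSEQ_D[OF lim] by (metis comp_apply order_refl)
    have "norm (X n - L) < e" if "n \<ge> r k" for n
    proof -
      have "X n \<le> X (r k)" using dec that by (simp add: decseq_def)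
      then have "norm (X n - L) \<le> norm (X (r k) - L)"
        using le[of n]
        by (intro phase_le_norm_mono) (auto simp: less_eq_phase_def less_eq_vec_def)
      with k show ?thesis by simp
    qed
    then show "\<exists>N. \<forall>n\<ge>N. norm (X n - L) < e" by blast
  qed
  then show thesis using le by (rule that)
qed

text \<open>
  Every element of the cone lies in some interval \<open>C\<^sub>r\<close>, so that the continuity and monotonicity in
  \<^const>\<open>A2\<close>, which are stated on those intervals, become usable on all of \<open>C\<^sub>+\<close>.
\<close>

lemma phase_dominated:
  fixes \<phi> :: "('m::topological_space, 'n::finite) phase"
  obtains r where "r \<in> int_orthant" "\<phi> \<le> of_vec r"
proof -
  obtain B where B: "\<And>p. norm (\<phi> p) \<le> B" using phase_bounded[of \<phi>] by blast
  have "\<phi> p $ i \<le> B + 1" for p i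
    using B[of p] component_le_norm_cart[of "\<phi> p" i] by linarith
  moreover have "0 \<le> B" using B norm_ge_zero order_trans by blast
  ultimately show thesis
    by (intro that[of "\<chi> i. B + 1"])
       (auto simp: int_orthant_iff less_eq_phase_def less_eq_vec_def)
qed

lemma of_Y_nonneg: "\<beta> \<in> IntYplus \<Longrightarrow> 0 \<le> of_Y \<beta>"
  by (auto simp: IntYplus_def int_orthant_iff less_eq_phase_def less_eq_vec_def less_imp_le)

section \<open>Iterates of monotone maps and translations\<close>

lemma shift_shift [simp]: "shift x (shift y \<phi>) = shift (x + y) \<phi>"
  by (rule phase_eqI) (auto simp: algebra_simps)

lemma shift_zero [simp]: "shift 0 \<phi> = \<phi>"
  by (rule phase_eqI) auto

lemma shift_of_Y [simp]: "shift y (of_Y \<beta>) = of_Y \<beta>"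
  by (rule phase_eqI) auto

lemma shift_mono: "\<phi> \<le> \<psi> \<Longrightarrow> shift y \<phi> \<le> shift y \<psi>"
  by (auto simp: less_eq_phase_def)

lemma shift_Cplus: "\<phi> \<in> Cplus \<Longrightarrow> shift y \<phi> \<in> Cplus"
  by (auto simp: Cplus_def less_eq_phase_def)

lemma A2_mono_on:
  assumes "A2 Q" shows "mono_on Cplus Q"
proof (rule mono_onI)
  fix \<phi> \<psi> :: "('a, 'b) phase"
  assume *: "\<phi> \<in> Cplus" "\<phi> \<le> \<psi>"
  obtain r where r: "r \<in> int_orthant" "\<psi> \<le> of_vec r" using phase_dominated .
  then have "\<phi> \<in> {0..of_vec r}" "\<psi> \<in> {0..of_vec r}"
    using * by (auto simp: Cplus_def intro: order_trans)
  with r * assms show "Q \<phi> \<le> Q \<psi>" by (auto simp: A2_def)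
qed

lemma A2_tendsto:
  assumes "A2 Q" "\<And>n. X n \<in> Cplus" "\<And>n. X n \<le> \<psi>" "X \<longlonglongrightarrow> L" "L \<in> Cplus" "L \<le> \<psi>"
  shows "(\<lambda>n. Q (X n)) \<longlonglongrightarrow> Q L"
proof -
  obtain r where r: "r \<in> int_orthant" "\<psi> \<le> of_vec r" using phase_dominated .
  have "continuous_on {0..of_vec r} Q" using assms(1) r by (auto simp: A2_def)
  then show ?thesis
    using assms(4)
  proof (rule continuous_on_tendsto_compose)
    show "L \<in> {0..of_vec r}" using assms r by (auto simp: Cplus_def intro: order_trans)
    show "\<forall>\<^sub>F n in sequentially. X n \<in> {0..of_vec r}"
      using assms(2,3) r by (auto simp: Cplus_def intro!: always_eventually intro: order_trans)
  qed
qed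

lemma funpow_self_map:
  assumes "self_map R" "\<phi> \<in> Cplus" shows "(R ^^ n) \<phi> \<in> Cplus"
  by (induction n) (use assms in \<open>auto simp: self_map_def\<close>)

lemma funpow_mono_on_Cplus:
  assumes "self_map R" "mono_on Cplus R" "\<phi> \<in> Cplus" "\<phi> \<le> \<psi>"
  shows "(R ^^ n) \<phi> \<le> (R ^^ n) \<psi>"
proof (induction n)
  case (Suc n)
  have "\<psi> \<in> Cplus" using assms by (auto simp: Cplus_def)
  then show ?case
    using Suc assms by (auto intro!: mono_onD[OF assms(2)] funpow_self_map)
qed (use assms in simp)

lemma decseq_funpow:
  assumes "self_map R" "mono_on Cplus R" "\<psi> \<in> Cplus" "R \<psi> \<le> \<psi>"
  shows "decseq (\<lambda>n. (R ^^ n) \<psi>)"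
proof (rule decseq_SucI)
  fix n
  have "(R ^^ n) (R \<psi>) \<le> (R ^^ n) \<psi>"
    by (rule funpow_mono_on_Cplus) (use assms in \<open>auto simp: self_map_def\<close>)
  then show "(R ^^ Suc n) \<psi> \<le> (R ^^ n) \<psi>" by (simp add: funpow_swap1)
qed

lemma subsolution_funpow:
  assumes "self_map R" "mono_on Cplus R" "\<psi> \<in> Cplus" "\<psi> \<le> R \<psi>"
  shows "\<psi> \<le> (R ^^ n) \<psi>"
proof (induction n)
  case (Suc n)
  have "R \<psi> \<le> R ((R ^^ n) \<psi>)"
    by (rule mono_onD[OF assms(2)]) (use assms Suc funpow_self_map in auto)
  then show ?case using assms(4) by simp
qed simp

lemma A1_shift_right:
  assumes "A1 Q" "\<phi> \<in> Cplus" "y \<ge> 0"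
  shows "shift y (Q \<phi>) \<le> Q (shift y \<phi>)"
proof -
  have "Q (shift (- y) (shift y \<phi>)) \<le> shift (- y) (Q (shift y \<phi>))"
    using assms(1,3) shift_Cplus[OF assms(2), of y] unfolding A1_def by blast
  from shift_mono[OF this, of y] show ?thesis by simp
qed

text \<open>
  Constants in \<open>x\<close> are fixed by every translation, so an orbit that starts from one stays monotone
  in \<open>x\<close>: the environment improves to the right.
\<close>

lemma A1_nondecreasing_funpow:
  assumes "self_map R" "mono_on Cplus R" "A1 R" "\<beta> \<in> IntYplus" "y \<ge> 0"
  shows "(R ^^ n) (of_Y \<beta>) \<le> shift (- y) ((R ^^ n) (of_Y \<beta>))"
proof (induction n)
  case (Suc n)
  let ?u = "(R ^^ n) (of_Y \<beta>)"
  have u: "?u \<in> Cplus"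
    using assms(1) of_Y_nonneg[OF assms(4)] by (intro funpow_self_map) (simp_all add: Cplus_def)
  have "R ?u \<le> R (shift (- y) ?u)"
    by (rule mono_onD[OF assms(2)]) (use u Suc shift_Cplus in auto)
  also have "\<dots> \<le> shift (- y) (R ?u)" using assms(3,5) u by (simp add: A1_def)
  finally show ?case by simp
qed simp

text \<open>
  The \<open>n\<close> translations that are interleaved with \<open>Q\<close> on the right-hand side can be collected in
  front, because by \<^const>\<open>A1\<close> it only helps to translate to the right before applying \<open>Q\<close>. This
  one-sided comparison transfers spreading of \<open>Q\<^sub>+\<close> to the drifted map, without limit maps for the
  latter.
\<close>

lemma drift_funpow_ge:
  assumes "self_map Q" "mono_on Cplus Q" "A1 Q" "\<phi> \<in> Cplus" "x0 \<ge> 0"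
  shows "shift (real n * x0) ((Q ^^ n) \<phi>) \<le> ((\<lambda>\<phi>. shift x0 (Q \<phi>)) ^^ n) \<phi>"
proof (induction n)
  case (Suc n)
  let ?u = "(Q ^^ n) \<phi>" and ?v = "((\<lambda>\<phi>. shift x0 (Q \<phi>)) ^^ n) \<phi>"
  have u: "?u \<in> Cplus" using assms by (auto intro: funpow_self_map)
  have "shift (real n * x0) (Q ?u) \<le> Q (shift (real n * x0) ?u)"
    by (rule A1_shift_right) (use assms u in auto)
  also have "\<dots> \<le> Q ?v"
    by (rule mono_onD[OF assms(2)])
       (use Suc shift_Cplus[OF u] in \<open>auto simp: Cplus_def intro: order_trans\<close>)
  finally have "shift x0 (shift (real n * x0) (Q ?u)) \<le> shift x0 (Q ?v)" by (rule shift_mono)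
  then show ?case by (simp add: algebra_simps)
qed simp

lemma drifted_map:
  assumes "self_map Q" "A1 Q" "A2 Q"
  shows "self_map (\<lambda>\<phi>. shift x0 (Q \<phi>))" "mono_on Cplus (\<lambda>\<phi>. shift x0 (Q \<phi>))"
    "A1 (\<lambda>\<phi>. shift x0 (Q \<phi>))"
proof -
  show "self_map (\<lambda>\<phi>. shift x0 (Q \<phi>))"
    using assms(1) by (auto simp: self_map_def shift_Cplus)
  show "mono_on Cplus (\<lambda>\<phi>. shift x0 (Q \<phi>))"
    using A2_mono_on[OF assms(3)] by (auto simp: mono_on_def intro: shift_mono)
  show "A1 (\<lambda>\<phi>. shift x0 (Q \<phi>))"
    unfolding A1_def
  proof (intro ballI allI impI)
    fix \<phi> :: "('a, 'b) phase" and y :: real assume "\<phi> \<in> Cplus" "y \<ge> 0"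
    then have "shift x0 (Q (shift (- y) \<phi>)) \<le> shift x0 (shift (- y) (Q \<phi>))"
      using assms(2) by (intro shift_mono) (auto simp: A1_def)
    then show "shift x0 (Q (shift (- y) \<phi>)) \<le> shift (- y) (shift x0 (Q \<phi>))"
      by (simp add: algebra_simps)
  qed
qed

section \<open>Spreading far to the right\<close>

text \<open>
  The spreading interval of \<^const>\<open>UC\<close> grows linearly, so around the point \<open>n s\<close>, with \<open>s\<close> strictly
  between the two speeds, it eventually contains a window of any fixed width.
\<close>

lemma UC_moving_window:
  fixes R :: "('m::topological_space, 'n::finite) phase \<Rightarrow> ('m, 'n) phase"
  assumes "UC R cm cp rs" "\<phi> \<in> Cplus" "\<phi> \<noteq> 0" "- cm < s" "s < cp" "e > 0"
  shows "\<exists>n>0. \<forall>\<theta> x. \<bar>x\<bar> \<le> L \<longrightarrow> norm ((R ^^ n) \<phi> (\<theta>, x + real n * s) - rs \<theta>) < e"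
proof -
  \<comment> \<open>A third of the distance of \<open>s\<close> to the speeds: one \<open>\<epsilon>\<close> is removed by \<^const>\<open>UC\<close>, and another
    leaves room \<open>n \<epsilon>\<close> for the window on either side of \<open>n s\<close>.\<close>
  define \<epsilon> where "\<epsilon> = min (s + cm) (cp - s) / 3"
  have \<epsilon>: "0 < \<epsilon>" "\<epsilon> < (cp + cm) / 2" "2 * \<epsilon> \<le> s + cm" "2 * \<epsilon> \<le> cp - s"
    using assms(4,5) by (auto simp: \<epsilon>_def min_def field_simps)
  let ?I = "\<lambda>n. {real n * (- cm + \<epsilon>)..real n * (cp - \<epsilon>)}"
  have "(\<lambda>n. SUP x\<in>?I n. norm (slice ((R ^^ n) \<phi>) x - rs)) \<longlonglongrightarrow> 0"
    using assms(1-3) \<epsilon> by (simp add: UC_def)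
  then have "\<forall>\<^sub>F n in sequentially. (SUP x\<in>?I n. norm (slice ((R ^^ n) \<phi>) x - rs)) < e"
    using assms(6) by (rule order_tendstoD)
  moreover have "\<forall>\<^sub>F n in sequentially. L / \<epsilon> \<le> real n \<and> n > 0"
    using filterlim_real_sequentially eventually_gt_at_top[of 0]
    by (auto simp: filterlim_at_top intro: eventually_conj)
  ultimately have "\<forall>\<^sub>F n in sequentially.
      (SUP x\<in>?I n. norm (slice ((R ^^ n) \<phi>) x - rs)) < e \<and> L / \<epsilon> \<le> real n \<and> n > 0"
    by (rule eventually_conj)
  then obtain n where n: "(SUP x\<in>?I n. norm (slice ((R ^^ n) \<phi>) x - rs)) < e" "L / \<epsilon> \<le> real n" "n > 0"
    by (auto simp: eventually_sequentially)
  let ?u = "(R ^^ n) \<phi>"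
  obtain B where B: "\<And>p. norm (?u p) \<le> B" using phase_bounded[of ?u] by blast
  have bdd: "bdd_above ((\<lambda>x. norm (slice ?u x - rs)) ` ?I n)"
  proof (rule bdd_aboveI2)
    fix x
    have "norm (slice ?u x) \<le> B"
      by (rule norm_bound) (use B in auto)
    then show "norm (slice ?u x - rs) \<le> B + norm rs"
      using norm_triangle_ineq4[of "slice ?u x" rs] by linarith
  qed
  have "norm (?u (\<theta>, x + real n * s) - rs \<theta>) < e" if x: "\<bar>x\<bar> \<le> L" for \<theta> x
  proof -
    have L: "L \<le> real n * \<epsilon>" using n(2) \<epsilon>(1) by (simp add: field_simps)
    have "real n * (2 * \<epsilon>) \<le> real n * (s + cm)" "real n * (2 * \<epsilon>) \<le> real n * (cp - s)"
      using \<epsilon> by (auto intro!: mult_left_mono)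
    then have "x + real n * s \<in> ?I n"
      using x L by (auto simp: algebra_simps)
    then have "norm (slice ?u (x + real n * s) - rs) \<le> (SUP x\<in>?I n. norm (slice ?u x - rs))"
      by (rule cSUP_upper) (rule bdd)
    moreover have "norm ((slice ?u (x + real n * s) - rs) \<theta>) \<le> norm (slice ?u (x + real n * s) - rs)"
      by (rule norm_bounded)
    ultimately show ?thesis using n(1) by simp
  qed
  with n(3) show ?thesis by blast
qed

text \<open>
  For fixed \<open>n\<close>, the \<open>n\<close>-th iterate of \<open>Q\<close> seen from a far right position \<open>y\<close> is close to the \<open>n\<close>-th
  iterate of \<open>Q\<^sub>+\<close>, which by \<^const>\<open>UC\<close> is close to \<open>r\<^sup>*\<close> in the window that moves with velocity
  \<open>- x0\<close>. Hence \<open>n\<close> must be chosen first and \<open>y\<close> afterwards. Applying a translation by \<open>n x0\<close> brings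
  the window back to \<open>y\<close>.
\<close>

lemma spreading_far_right:
  fixes Q :: "('m::topological_space, 'n::finite) phase \<Rightarrow> ('m, 'n) phase"
  assumes A3: "A3 Q" and UC: "UC (limit_map at_top Q) cm cp rs"
    and \<phi>: "\<phi> \<in> Cplus" "\<phi> \<noteq> 0" and x0: "- cp < x0" "x0 < cm" and e: "e > 0"
  shows "\<exists>n>0. \<forall>\<^sub>F y in at_top. \<forall>\<theta> x. \<bar>x\<bar> \<le> L \<longrightarrow>
      norm ((Q ^^ n) (shift y \<phi>) (\<theta>, x - real n * x0 + y) - rs \<theta>) < e"
proof -
  have "e / 2 > 0" using e by simp
  from UC_moving_window[OF UC \<phi> _ _ this, of "- x0" L] x0
  obtain n where "n > 0" and n: "\<And>\<theta> x. \<bar>x\<bar> \<le> L \<Longrightarrow>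
      norm ((limit_map at_top Q ^^ n) \<phi> (\<theta>, x - real n * x0) - rs \<theta>) < e / 2"
    by auto
  have "((\<lambda>y. shift (- y) ((Q ^^ n) (shift y \<phi>))) \<longlongrightarrow> (limit_map at_top Q ^^ n) \<phi>) at_top"
    using A3 \<phi> by (simp add: A3_def)
  from tendsto_phase_locally_uniform[OF this \<open>e / 2 > 0\<close>, of "\<bar>L\<bar> + \<bar>real n * x0\<bar>"]
  have "\<forall>\<^sub>F y in at_top. \<forall>\<theta> x. \<bar>x\<bar> \<le> L \<longrightarrow>
      norm ((Q ^^ n) (shift y \<phi>) (\<theta>, x - real n * x0 + y) - rs \<theta>) < e"
  proof (eventually_elim, intro allI impI)
    fix y \<theta> x
    assume *: "\<forall>\<theta> x. \<bar>x\<bar> \<le> \<bar>L\<bar> + \<bar>real n * x0\<bar> \<longrightarrow>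
        norm (shift (- y) ((Q ^^ n) (shift y \<phi>)) (\<theta>, x) - (limit_map at_top Q ^^ n) \<phi> (\<theta>, x)) < e / 2"
      and x: "\<bar>x\<bar> \<le> L"
    have "\<bar>x - real n * x0\<bar> \<le> \<bar>L\<bar> + \<bar>real n * x0\<bar>" using x by linarith
    with * have "norm ((Q ^^ n) (shift y \<phi>) (\<theta>, x - real n * x0 + y)
        - (limit_map at_top Q ^^ n) \<phi> (\<theta>, x - real n * x0)) < e / 2"
      by fastforce
    from norm_triangle_lt[OF add_strict_mono[OF this n[OF x, of \<theta>], simplified]]
    show "norm ((Q ^^ n) (shift y \<phi>) (\<theta>, x - real n * x0 + y) - rs \<theta>) < e"
      by simp
  qed
  with \<open>n > 0\<close> show ?thesis by blast
qed

text \<open>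
  A nonzero datum that vanishes for \<open>\<bar>x\<bar> \<ge> 1\<close> and stays below \<open>\<beta> / 2\<close>. The factor \<open>1 / 2\<close> is the
  room needed to lie below any state that is merely close to \<open>\<beta>\<close> on \<open>[- 1, 1]\<close>.
\<close>

lift_definition bump :: "('m::topological_space \<Rightarrow>\<^sub>C (real ^ 'n::finite)) \<Rightarrow> ('m, 'n) phase"
  is "\<lambda>\<beta> p. (max 0 (1 - \<bar>snd p\<bar>) / 2) *\<^sub>R \<beta> (fst p)"
proof -
  fix \<beta> :: "'m \<Rightarrow> real ^ 'n" assume \<beta>: "\<beta> \<in> bcontfun"
  then have c: "continuous_on UNIV \<beta>" and "bounded (range \<beta>)" by (auto simp: bcontfun_def)
  then obtain B where B: "\<And>\<theta>. norm (\<beta> \<theta>) \<le> B" by (auto simp: bounded_iff)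
  have "norm ((max 0 (1 - \<bar>snd p\<bar>) / 2) *\<^sub>R \<beta> (fst p)) \<le> 1 * B" for p :: "'m \<times> real"
    unfolding norm_scaleR by (intro mult_mono B) auto
  then have "bounded (range (\<lambda>p :: 'm \<times> real. (max 0 (1 - \<bar>snd p\<bar>) / 2) *\<^sub>R \<beta> (fst p)))"
    unfolding bounded_iff by blast
  moreover have "continuous_on UNIV (\<lambda>p :: 'm \<times> real. (max 0 (1 - \<bar>snd p\<bar>) / 2) *\<^sub>R \<beta> (fst p))"
    by (intro continuous_intros continuous_on_compose2[OF c]) auto
  ultimately show "(\<lambda>p :: 'm \<times> real. (max 0 (1 - \<bar>snd p\<bar>) / 2) *\<^sub>R \<beta> (fst p)) \<in> bcontfun"
    by (simp add: bcontfun_def)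
qed

lemma apply_bump: "bump \<beta> (\<theta>, x) = (max 0 (1 - \<bar>x\<bar>) / 2) *\<^sub>R \<beta> \<theta>"
  by transfer simp

lemma bump_bounds:
  assumes "\<beta> \<in> IntYplus"
  shows "bump \<beta> \<in> Cplus" "bump \<beta> \<noteq> 0" "bump \<beta> \<le> of_Y \<beta>" "bump \<beta> (\<theta>, x) $ i \<le> \<beta> \<theta> $ i / 2"
    "\<bar>x\<bar> > 1 \<Longrightarrow> bump \<beta> (\<theta>, x) = 0"
proof -
  have pos: "\<beta> \<theta> $ i > 0" for \<theta> i
    using assms by (auto simp: IntYplus_def int_orthant_iff)
  show half: "bump \<beta> (\<theta>, x) $ i \<le> \<beta> \<theta> $ i / 2" for \<theta> x i
    using mult_right_mono[of "max 0 (1 - \<bar>x\<bar>) / 2" "1 / 2" "\<beta> \<theta> $ i"] pos[of \<theta> i]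
    by (simp add: apply_bump)
  show "bump \<beta> \<in> Cplus"
    using less_imp_le[OF pos]
    by (auto simp: Cplus_def less_eq_phase_def less_eq_vec_def apply_bump intro!: mult_nonneg_nonneg)
  show "bump \<beta> \<le> of_Y \<beta>"
    unfolding less_eq_phase_def less_eq_vec_def
  proof (intro allI)
    fix p i show "bump \<beta> p $ i \<le> of_Y \<beta> p $ i"
      using half[of "fst p" "snd p" i] pos[of "fst p" i] by simp
  qed
  show "bump \<beta> (\<theta>, x) = 0" if "\<bar>x\<bar> > 1"
    using that by (simp add: apply_bump)
  have "bump \<beta> (undefined, 0) $ undefined \<noteq> 0"
    using pos[of undefined undefined] by (simp add: apply_bump)
  then show "bump \<beta> \<noteq> 0" by auto
qed

lemma IntYplus_uniformly_positive:
  fixes \<beta> :: "'m::topological_space \<Rightarrow>\<^sub>C (real ^ 'n::finite)"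
  assumes "compact (UNIV :: 'm set)" "\<beta> \<in> IntYplus"
  obtains d where "d > 0" "\<And>\<theta> i. d \<le> \<beta> \<theta> $ i"
proof -
  have pos: "\<beta> \<theta> $ i > 0" for \<theta> i
    using assms by (auto simp: IntYplus_def int_orthant_iff)
  have "\<exists>d>0. \<forall>\<theta>. d \<le> \<beta> \<theta> $ i" for i
  proof -
    have "continuous_on UNIV (\<lambda>\<theta>. \<beta> \<theta> $ i)"
      by (intro continuous_intros) auto
    from continuous_attains_inf[OF assms(1) _ this] show ?thesis using pos by auto
  qed
  then obtain d where d: "\<And>i. d i > 0" "\<And>\<theta> i. d i \<le> \<beta> \<theta> $ i" by metis
  show thesis
  proof (rule that[of "Min (range d)"])
    show "Min (range d) > 0" using d by simp
    show "Min (range d) \<le> \<beta> \<theta> $ i" for \<theta> i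
      by (rule order_trans[OF Min_le d(2)]) simp_all
  qed
qed

text \<open>
  The bump spreads to a state near \<open>r\<^sup>*\<close> on the window that carries its support, so it is
  exceeded by its own image there; elsewhere it vanishes. The requirement \<open>n > 0\<close> excludes the
  vacuous comparison of the bump with itself.
\<close>

lemma bump_subsolution_far_right:
  fixes Q :: "('m::topological_space, 'n::finite) phase \<Rightarrow> ('m, 'n) phase"
  assumes comp: "compact (UNIV :: 'm set)"
    and Q: "self_map Q" "A1 Q" "A2 Q" "A3 Q"
    and UC: "UC (limit_map at_top Q) cm cp rs" and rs: "rs \<in> IntYplus"
    and x0: "0 \<le> x0" "- cp < x0" "x0 < cm"
  obtains n y where "n > 0" "shift y (bump rs) \<le> ((\<lambda>\<phi>. shift x0 (Q \<phi>)) ^^ n) (shift y (bump rs))"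
proof -
  obtain d where d: "d > 0" "\<And>\<theta> i. d \<le> rs \<theta> $ i"
    using IntYplus_uniformly_positive[OF comp rs] by blast
  from spreading_far_right[OF Q(4) UC bump_bounds(1,2)[OF rs] x0(2,3), of "d / 2" 1] d(1)
  obtain n where "n > 0" and "\<forall>\<^sub>F y in at_top. \<forall>\<theta> x. \<bar>x\<bar> \<le> 1 \<longrightarrow>
      norm ((Q ^^ n) (shift y (bump rs)) (\<theta>, x - real n * x0 + y) - rs \<theta>) < d / 2"
    by auto
  from this(2) obtain y where y: "\<And>\<theta> x. \<bar>x\<bar> \<le> 1 \<Longrightarrow>
      norm ((Q ^^ n) (shift y (bump rs)) (\<theta>, x - real n * x0 + y) - rs \<theta>) < d / 2"
    by (auto simp: eventually_at_top_linorder)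
  let ?\<phi> = "shift y (bump rs)"
  let ?u = "(Q ^^ n) ?\<phi>"
  have \<phi>: "?\<phi> \<in> Cplus" by (intro shift_Cplus bump_bounds(1) rs)
  then have u: "?u \<in> Cplus" using Q(1) by (intro funpow_self_map)
  have "?\<phi> \<le> shift (real n * x0) ?u"
    unfolding less_eq_phase_def less_eq_vec_def split_paired_all
  proof (intro allI, clarify)
    fix \<theta> x i
    show "?\<phi> (\<theta>, x) $ i \<le> shift (real n * x0) ?u (\<theta>, x) $ i"
    proof (cases "\<bar>x - y\<bar> \<le> 1")
      case True
      have "\<bar>(?u (\<theta>, x - real n * x0) - rs \<theta>) $ i\<bar> < d / 2"
        using y[OF True, of \<theta>] component_le_norm_cart[of "?u (\<theta>, x - real n * x0) - rs \<theta>" i]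
        by (simp add: algebra_simps)
      then show ?thesis
        using bump_bounds(4)[OF rs, of \<theta> "x - y" i] d(2)[of \<theta> i]
        unfolding abs_less_iff by simp
    next
      case False
      then show ?thesis
        using u bump_bounds(5)[OF rs, of "x - y" \<theta>]
        by (auto simp: Cplus_def less_eq_phase_def less_eq_vec_def)
    qed
  qed
  also have "\<dots> \<le> ((\<lambda>\<phi>. shift x0 (Q \<phi>)) ^^ n) ?\<phi>"
    by (intro drift_funpow_ge Q A2_mono_on \<phi> x0)
  finally have "?\<phi> \<le> ((\<lambda>\<phi>. shift x0 (Q \<phi>)) ^^ n) ?\<phi>" .
  with \<open>n > 0\<close> show thesis by (rule that)
qed

section \<open>The barrier and the wave\<close>

text \<open>
  The barrier \<open>V\<close> is the limit of the decreasing orbit of \<open>r\<^sup>*\<close> under the drifted map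
  \<open>R = T\<^bsub>x0\<^esub> \<circ> Q\<close>, hence a fixed point of \<open>R\<close> that is nondecreasing in \<open>x\<close>. The translated bump is a
  subsolution below the orbit, so \<open>V \<noteq> 0\<close>. Then the spreading of \<open>V\<close> itself gives the limit \<open>r\<^sup>*\<close> at
  \<open>\<infinity>\<close>: as \<open>T\<^sub>y V \<le> V\<close>, we have \<open>V = R\<^sup>n V \<ge> R\<^sup>n (T\<^sub>y V) \<ge> T\<^bsub>n x0\<^esub> Q\<^sup>n (T\<^sub>y V)\<close>, and the right-hand
  side is near \<open>r\<^sup>*\<close> at the point \<open>y\<close>. Finally, monotonicity and \<open>x0 \<ge> 0\<close> turn the fixed point of
  \<open>R\<close> into a subsolution of \<open>Q\<close>: \<open>Q V = T\<^bsub>- x0\<^esub> V \<ge> V\<close>.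
\<close>

lemma drifted_orbit_limit:
  fixes Q :: "('m::topological_space, 'n::finite) phase \<Rightarrow> ('m, 'n) phase"
  assumes comp: "compact (UNIV :: 'm set)"
    and Q: "self_map Q" "A1 Q" "A2 Q" "A3 Q"
    and UC: "UC (limit_map at_top Q) cm cp rs" and rs: "rs \<in> IntYplus"
    and super: "Q (of_Y rs) \<le> of_Y rs"
    and x0: "0 \<le> x0" "- cp < x0" "x0 < cm"
    and pre: "precompact {((\<lambda>\<phi>. shift x0 (Q \<phi>)) ^^ n) (of_Y rs) | n. True}"
  obtains V where "V \<in> Cplus" "V \<le> of_Y rs" "V \<le> Q V" "(slice V \<longlongrightarrow> rs) at_top"
proof -
  define R where "R = (\<lambda>\<phi>. shift x0 (Q \<phi>))"
  have R: "self_map R" "mono_on Cplus R" "A1 R"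
    unfolding R_def by (intro drifted_map Q)+
  have rsC: "of_Y rs \<in> Cplus" using of_Y_nonneg[OF rs] by (simp add: Cplus_def)
  have "R (of_Y rs) \<le> of_Y rs"
    using shift_mono[OF super, of x0] by (simp add: R_def)
  then have dec: "decseq (\<lambda>n. (R ^^ n) (of_Y rs))"
    using R rsC by (intro decseq_funpow)
  have "precompact (range (\<lambda>n. (R ^^ n) (of_Y rs)))"
    using pre by (simp add: R_def full_SetCompr_eq)
  with dec obtain V where lim: "(\<lambda>n. (R ^^ n) (of_Y rs)) \<longlonglongrightarrow> V"
    and le: "\<And>n. V \<le> (R ^^ n) (of_Y rs)"
    by (rule decreasing_precompact_converges) blast
  have RnC: "(R ^^ n) (of_Y rs) \<in> Cplus" for n
    using R(1) rsC by (rule funpow_self_map)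
  have "0 \<le> V"
    by (rule phase_tendsto_le[OF _ tendsto_const lim]) (use RnC in \<open>auto simp: Cplus_def\<close>)
  then have V: "V \<in> Cplus" by (simp add: Cplus_def)
  have V_le: "V \<le> of_Y rs" using le[of 0] by simp
  \<comment> \<open>Taken pointwise, the limit of \<open>Q (R\<^sup>n[r\<^sup>*])\<close> commutes with the translation in \<open>R\<close>.\<close>
  have fixed: "R V = V"
  proof (rule phase_eqI)
    fix p :: "'m \<times> real"
    obtain \<theta> x where p: "p = (\<theta>, x)" by force
    have "(\<lambda>n. Q ((R ^^ n) (of_Y rs))) \<longlonglongrightarrow> Q V"
      by (rule A2_tendsto[OF Q(3) RnC _ lim V V_le]) (use dec in \<open>force simp: decseq_def\<close>)
    from tendsto_apply_phase[OF this, of "(\<theta>, x - x0)"]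
    have "(\<lambda>n. (R ^^ Suc n) (of_Y rs) p) \<longlonglongrightarrow> R V p"
      by (simp add: R_def p)
    moreover have "(\<lambda>n. (R ^^ Suc n) (of_Y rs) p) \<longlonglongrightarrow> V p"
      using tendsto_apply_phase[OF lim, of p] by (rule LIMSEQ_Suc)
    ultimately show "R V p = V p" by (rule LIMSEQ_unique)
  qed
  have fixed_pow: "(R ^^ n) V = V" for n by (induction n) (simp_all add: fixed)
  have incr: "V \<le> shift (- y) V" if "y \<ge> 0" for y
    unfolding less_eq_phase_def less_eq_vec_def split_paired_all
  proof (intro allI, clarify)
    fix \<theta> x i
    have "(R ^^ n) (of_Y rs) (\<theta>, x) $ i \<le> (R ^^ n) (of_Y rs) (\<theta>, x + y) $ i" for n
      using A1_nondecreasing_funpow[OF R rs that, of n]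
      by (auto simp: less_eq_phase_def less_eq_vec_def)
    then show "V (\<theta>, x) $ i \<le> shift (- y) V (\<theta>, x) $ i"
      by (auto intro!: tendsto_le[OF sequentially_bot] tendsto_vec_nth tendsto_apply_phase lim)
  qed
  have "V \<noteq> 0"
  proof -
    obtain n y where "n > 0" and sub: "shift y (bump rs) \<le> (R ^^ n) (shift y (bump rs))"
      unfolding R_def using bump_subsolution_far_right[OF comp Q UC rs x0] .
    let ?\<phi> = "shift y (bump rs)"
    have \<phi>: "?\<phi> \<in> Cplus" by (intro shift_Cplus bump_bounds rs)
    have \<phi>_le: "?\<phi> \<le> of_Y rs" using shift_mono[OF bump_bounds(3)[OF rs], of y] by simp
    have "?\<phi> \<le> (R ^^ m) (of_Y rs)" for m
    proof -
      have "?\<phi> \<le> ((R ^^ n) ^^ m) ?\<phi>"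
      proof (rule subsolution_funpow[where R = "R ^^ n"])
        show "self_map (R ^^ n)" using funpow_self_map[OF R(1)] by (auto simp: self_map_def)
        show "mono_on Cplus (R ^^ n)"
          using funpow_mono_on_Cplus[OF R(1,2)] by (auto simp: mono_on_def)
        show "?\<phi> \<in> Cplus" "?\<phi> \<le> (R ^^ n) ?\<phi>" by fact+
      qed
      also have "\<dots> \<le> (R ^^ (n * m)) (of_Y rs)"
        using funpow_mono_on_Cplus[OF R(1,2) \<phi> \<phi>_le, of "n * m"] by (simp add: funpow_mult mult.commute)
      also have "\<dots> \<le> (R ^^ m) (of_Y rs)"
        using dec \<open>n > 0\<close> by (auto simp: decseq_def)
      finally show ?thesis .
    qed
    then have "?\<phi> \<le> V"
      by (intro phase_tendsto_le[OF _ tendsto_const lim]) auto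
    moreover have "?\<phi> \<noteq> 0"
    proof
      assume "?\<phi> = 0"
      then have "shift (- y) ?\<phi> = shift (- y) 0" by simp
      also have "shift (- y) 0 = (0 :: ('m, 'n) phase)" by (rule phase_eqI) (simp add: split_paired_all)
      finally show False using bump_bounds(2)[OF rs] by simp
    qed
    ultimately show ?thesis using \<phi> by (auto simp: Cplus_def)
  qed
  have "(slice V \<longlongrightarrow> rs) at_top"
  proof (rule tendstoI)
    fix e :: real assume "e > 0"
    then have "e / 2 > 0" by simp
    from spreading_far_right[OF Q(4) UC V \<open>V \<noteq> 0\<close> x0(2,3) this, of 0]
    obtain n where n: "\<forall>\<^sub>F y in at_top. \<forall>\<theta>.
        norm ((Q ^^ n) (shift y V) (\<theta>, y - real n * x0) - rs \<theta>) < e / 2"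
      by auto
    show "\<forall>\<^sub>F y in at_top. dist (slice V y) rs < e"
      using n eventually_ge_at_top[of 0]
    proof eventually_elim
      case (elim y)
      have "dist (slice V y) rs \<le> e / 2"
      proof (rule dist_bound)
        fix \<theta>
        let ?l = "(Q ^^ n) (shift y V) (\<theta>, y - real n * x0)"
        have "shift y V \<le> V" using shift_mono[OF incr[OF elim(2)], of y] by simp
        have "shift (real n * x0) ((Q ^^ n) (shift y V)) \<le> (R ^^ n) (shift y V)"
          unfolding R_def by (intro drift_funpow_ge Q A2_mono_on shift_Cplus V x0)
        also have "\<dots> \<le> (R ^^ n) V"
          by (intro funpow_mono_on_Cplus R shift_Cplus V) fact
        finally have "shift (real n * x0) ((Q ^^ n) (shift y V)) \<le> V" by (simp add: fixed_pow)
        then have "shift (real n * x0) ((Q ^^ n) (shift y V)) (\<theta>, y) \<le> V (\<theta>, y)"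
          unfolding less_eq_phase_def by blast
        then have "?l \<le> V (\<theta>, y)" by simp
        moreover have "V (\<theta>, y) \<le> rs \<theta>"
          using V_le by (force simp: less_eq_phase_def)
        ultimately have "norm (rs \<theta> - V (\<theta>, y)) \<le> norm (rs \<theta> - ?l)"
          by (intro norm_mono_orthant) (auto simp: less_eq_vec_def)
        also have "\<dots> < e / 2" using elim(1) by (simp add: norm_minus_commute)
        finally show "dist (slice V y \<theta>) (rs \<theta>) \<le> e / 2"
          by (simp add: dist_norm norm_minus_commute)
      qed
      with \<open>e > 0\<close> show ?case by simp
    qed
  qed
  moreover have "V \<le> Q V"
  proof -
    have "V \<le> shift (- x0) V" by (rule incr[OF x0(1)])
    also have "\<dots> = shift (- x0) (R V)" by (simp add: fixed)
    also have "\<dots> = Q V" by (simp add: R_def)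
    finally show ?thesis .
  qed
  ultimately show thesis using V V_le by (intro that)
qed

theorem theorem5p2:
  fixes P Q :: "real \<Rightarrow> ('m::topological_space, 'n::finite) phase \<Rightarrow> ('m, 'n) phase"
    and rs :: "'m \<Rightarrow>\<^sub>C (real ^ 'n)"
    and c cm cp t0 :: real
  assumes "compact (UNIV :: 'm set)"
    and "continuous_family P"
    and Q_def: "\<And>t \<phi>. Q t \<phi> = shift (- (c * t)) (P t \<phi>)"
    and "semiflow Q"
    and "\<And>t. t \<ge> 0 \<Longrightarrow> A1 (Q t) \<and> A2 (Q t)"
    and "t0 > 0"
    and "A3 (Q t0)"
    and "A4 (Q t0) rs"
    and "UAA (limit_map at_bot (Q t0))"
    and "UC (limit_map at_top (Q t0)) cm cp rs"
    and "(subhomogeneous (Q t0) rs \<and> SP (Q t0)) \<or> ASH_UC_SP (Q t0) rs cm cp"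
    and "precompact {(Q t0 ^^ n) (of_Y rs) | n. True}"
    and "cp \<le> 0 \<Longrightarrow>
      \<exists>x0\<in>{- cp<..<cm}. precompact {((\<lambda>\<phi>. shift x0 (Q t0 \<phi>)) ^^ n) (of_Y rs) | n. True}"
    and "\<And>t. t \<ge> 0 \<Longrightarrow> Q t (of_Y rs) \<le> of_Y rs"
    and "cm > 0"
  shows "\<exists>W. travelling_wave P c rs W"
proof -
  note comp = assms(1) and A12 = assms(5) and A3 = assms(7)
    and UC = assms(10) and super = assms(14)
  have rs: "rs \<in> IntYplus" using assms(8) by (simp add: A4_def)
  have rsC: "of_Y rs \<in> Cplus" using of_Y_nonneg[OF rs] by (simp add: Cplus_def)
  have self: "self_map (Q t)" if "t \<ge> 0" for t
    using assms(4) that by (simp add: semiflow_def continuous_family_def)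
  have mono: "mono_on Cplus (Q t)" if "t \<ge> 0" for t
    using A12[OF that] by (intro A2_mono_on) simp
  have semi: "Q t (Q s \<phi>) = Q (t + s) \<phi>" if "t \<ge> 0" "s \<ge> 0" "\<phi> \<in> Cplus" for t s \<phi>
    using assms(4) that by (simp add: semiflow_def)
  have zero: "Q 0 \<phi> = \<phi>" if "\<phi> \<in> Cplus" for \<phi>
    using assms(4) that by (simp add: semiflow_def)
  have t0: "t0 \<ge> 0" using assms(6) by simp
  have orbit_C: "Q t (of_Y rs) \<in> Cplus" if "t \<ge> 0" for t
    using self[OF that] rsC by (simp add: self_map_def)
  have orbit_dec: "Q t (of_Y rs) \<le> Q s (of_Y rs)" if "0 \<le> s" "s \<le> t" for s t
  proof -
    have "Q s (Q (t - s) (of_Y rs)) \<le> Q s (of_Y rs)"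
      using that by (intro mono_onD[OF mono] super orbit_C rsC) auto
    then show ?thesis using that semi[of s "t - s" "of_Y rs"] rsC by simp
  qed
  have pow: "(Q t0 ^^ n) (of_Y rs) = Q (real n * t0) (of_Y rs)" for n
  proof (induction n)
    case (Suc n)
    then show ?case using semi[of t0 "real n * t0" "of_Y rs"] t0 rsC by (simp add: algebra_simps)
  qed (simp add: zero rsC)
  \<comment> \<open>The profile is the limit of the decreasing orbit of \<open>r\<^sup>*\<close> along multiples of \<open>t0\<close>.\<close>
  define X where "X = (\<lambda>n. Q (real n * t0) (of_Y rs))"
  have "decseq X"
    unfolding decseq_def X_def using t0 by (auto intro!: orbit_dec mult_right_mono)
  moreover have "precompact (range X)"
    using assms(12) by (simp add: pow X_def full_SetCompr_eq)
  ultimately obtain W where lim: "X \<longlonglongrightarrow> W" and le: "\<And>n. W \<le> X n"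
    by (rule decreasing_precompact_converges) blast
  have XC: "X n \<in> Cplus" for n unfolding X_def using t0 by (intro orbit_C) simp
  have W0: "0 \<le> W"
    by (rule phase_tendsto_le[OF _ tendsto_const lim]) (use XC in \<open>auto simp: Cplus_def\<close>)
  then have W: "W \<in> Cplus" by (simp add: Cplus_def)
  have W_le: "W \<le> of_Y rs" using le[of 0] by (simp add: X_def zero rsC)
  have X_le: "X n \<le> of_Y rs" for n unfolding X_def using t0 by (intro super) simp

  \<comment> \<open>Discrete times suffice for a rest point of the whole semiflow: the orbit decreases in
    continuous time, so at the time \<open>t + n t0\<close> it lies between \<open>X (m + n)\<close> and \<open>X n\<close>.\<close>
  have fixed: "Q t W = W" if t: "t \<ge> 0" for t
  proof -
    have "(\<lambda>n. Q t (X n)) \<longlonglongrightarrow> Q t W"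
      using A12[OF t] XC X_le lim W W_le by (intro A2_tendsto[of "Q t"]) auto
    moreover have "Q t (X n) = Q (t + real n * t0) (of_Y rs)" for n
      unfolding X_def using t t0 rsC by (intro semi) auto
    ultimately have lim_t: "(\<lambda>n. Q (t + real n * t0) (of_Y rs)) \<longlonglongrightarrow> Q t W" by simp
    obtain m where m: "t \<le> real m * t0"
      using ex_less_of_nat_mult[OF assms(6), of t] by (auto intro: less_imp_le)
    have "Q t W \<le> W"
      by (rule phase_tendsto_le[OF _ lim_t lim])
         (use t t0 in \<open>auto simp: X_def intro!: always_eventually orbit_dec\<close>)
    moreover have "W \<le> Q t W"
    proof (rule phase_tendsto_le[OF _ tendsto_const lim_t])
      have "W \<le> Q (t + real n * t0) (of_Y rs)" for n
      proof -
        have "W \<le> X (m + n)" by (rule le)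
        also have "\<dots> \<le> Q (t + real n * t0) (of_Y rs)"
          unfolding X_def using m t t0 by (intro orbit_dec) (auto simp: algebra_simps)
        finally show ?thesis .
      qed
      then show "\<forall>\<^sub>F n in sequentially. W \<le> Q (t + real n * t0) (of_Y rs)" by simp
    qed simp
    ultimately show ?thesis by (rule antisym)
  qed

  \<comment> \<open>The admissible drift is \<open>0\<close> if \<open>0\<close> lies between the spreading speeds; otherwise \<open>cp \<le> 0\<close>, and any
    \<open>x0 > - cp\<close> is nonnegative.\<close>
  have "\<exists>x0\<ge>0. - cp < x0 \<and> x0 < cm \<and>
      precompact {((\<lambda>\<phi>. shift x0 (Q t0 \<phi>)) ^^ n) (of_Y rs) | n. True}"
  proof (cases "cp \<le> 0")
    case True
    from assms(13)[OF this] obtain x0 where "x0 \<in> {- cp<..<cm}"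
      and "precompact {((\<lambda>\<phi>. shift x0 (Q t0 \<phi>)) ^^ n) (of_Y rs) | n. True}" ..
    with True show ?thesis by (intro exI[of _ x0]) auto
  next
    case False
    with assms(12,15) show ?thesis by (intro exI[of _ 0]) simp
  qed
  then obtain x0 where x0: "0 \<le> x0" "- cp < x0" "x0 < cm"
    and pre: "precompact {((\<lambda>\<phi>. shift x0 (Q t0 \<phi>)) ^^ n) (of_Y rs) | n. True}"
    by blast
  obtain V where V: "V \<in> Cplus" "V \<le> of_Y rs" "V \<le> Q t0 V" "(slice V \<longlongrightarrow> rs) at_top"
    using drifted_orbit_limit[OF comp self[OF t0] _ _ A3 UC rs super[OF t0] x0 pre] A12[OF t0]
    by blast
  have V_le_X: "V \<le> X n" for n
  proof -
    have "V \<le> (Q t0 ^^ n) V" by (intro subsolution_funpow self mono t0 V)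
    also have "\<dots> \<le> (Q t0 ^^ n) (of_Y rs)" by (intro funpow_mono_on_Cplus self mono t0 V)
    finally show ?thesis by (simp add: pow X_def)
  qed
  have "V \<le> W"
    by (rule phase_tendsto_le[OF _ tendsto_const lim]) (use V_le_X in auto)

  have at_top: "(slice W \<longlongrightarrow> rs) at_top"
  proof (rule tendstoI)
    fix e :: real assume "e > 0"
    then have "\<forall>\<^sub>F y in at_top. dist (slice V y) rs < e" by (rule tendstoD[OF V(4)])
    then show "\<forall>\<^sub>F y in at_top. dist (slice W y) rs < e"
    proof eventually_elim
      case (elim y)
      have "dist (slice W y) rs \<le> dist (slice V y) rs"
      proof (rule dist_bound)
        fix \<theta>
        have "V (\<theta>, y) \<le> W (\<theta>, y)" "W (\<theta>, y) \<le> rs \<theta>"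
          using \<open>V \<le> W\<close> W_le by (force simp: less_eq_phase_def)+
        then have "norm (rs \<theta> - W (\<theta>, y)) \<le> norm (rs \<theta> - V (\<theta>, y))"
          by (intro norm_mono_orthant) (auto simp: less_eq_vec_def)
        also have "\<dots> \<le> dist (slice V y) rs"
          using dist_bounded[of "slice V y" \<theta> rs] by (simp add: dist_norm norm_minus_commute)
        finally show "dist (slice W y \<theta>) (rs \<theta>) \<le> dist (slice V y) rs"
          by (simp add: dist_norm norm_minus_commute)
      qed
      with elim show ?case by simp
    qed
  qed

  \<comment> \<open>\<open>W\<close> lies below \<open>Q\<^sup>n [r\<^sup>*]\<close> for every \<open>n\<close>, and far to the left this is close to \<open>Q\<^sub>-\<^sup>n [r\<^sup>*]\<close>, which
    is small by \<^const>\<open>UAA\<close> once \<open>n\<close> is large.\<close>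
  have at_bot: "(slice W \<longlongrightarrow> 0) at_bot"
  proof (rule tendstoI)
    fix e :: real assume "e > 0"
    then have e: "e / 3 > 0" by simp
    let ?L = "\<lambda>n. (limit_map at_bot (Q t0) ^^ n) (of_Y rs)"
    let ?s = "\<lambda>n. \<chi> i. SUP p. ?L n p $ i"
    have "?s \<longlonglongrightarrow> 0" using assms(9) rsC by (simp add: UAA_def)
    from LIMSEQ_D[OF this e] obtain n where n: "norm (?s n) < e / 3" by auto
    have conv: "((\<lambda>y. shift (- y) ((Q t0 ^^ n) (of_Y rs))) \<longlongrightarrow> ?L n) at_bot"
    proof -
      have "((\<lambda>y. shift (- y) ((Q t0 ^^ n) (shift y (of_Y rs)))) \<longlongrightarrow> ?L n) at_bot"
        using A3 rsC unfolding A3_def by blast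
      then show ?thesis by simp
    qed
    have L0: "0 \<le> ?L n"
      by (rule phase_tendsto_le[OF _ tendsto_const conv])
         (use shift_Cplus[OF funpow_self_map[OF self[OF t0] rsC]] in \<open>auto simp: Cplus_def\<close>)
    have L_small: "norm (?L n p) < e / 3" for p
    proof -
      have "?L n p \<le> ?s n"
        unfolding less_eq_vec_def
      proof (intro allI)
        fix i
        obtain B where B: "\<And>p. norm (?L n p) \<le> B" using phase_bounded[of "?L n"] by blast
        have "bdd_above (range (\<lambda>p. ?L n p $ i))"
          by (rule bdd_aboveI2[of _ _ B])
             (use B component_le_norm_cart in \<open>metis abs_le_D1 order_trans\<close>)
        then show "?L n p $ i \<le> ?s n $ i" by (auto intro: cSUP_upper)
      qed
      moreover have "0 \<le> ?L n p" using phase_leD[OF L0, of p] by simp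
      ultimately have "norm (?L n p) \<le> norm (?s n)" by (intro norm_mono_orthant)
      with n show ?thesis by simp
    qed
    from tendsto_phase_locally_uniform[OF conv e, of 0]
    show "\<forall>\<^sub>F y in at_bot. dist (slice W y) 0 < e"
    proof eventually_elim
      case (elim y)
      have "dist (slice W y) 0 \<le> 2 * (e / 3)"
      proof (rule dist_bound)
        fix \<theta>
        let ?u = "(Q t0 ^^ n) (of_Y rs) (\<theta>, y)"
        have "W (\<theta>, y) \<le> ?u" "0 \<le> W (\<theta>, y)"
          using le[of n] W0 by (auto simp: pow X_def less_eq_phase_def)
        then have "norm (W (\<theta>, y)) \<le> norm ?u" by (intro norm_mono_orthant)
        also have "\<dots> \<le> norm (?u - ?L n (\<theta>, 0)) + norm (?L n (\<theta>, 0))"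
          using norm_triangle_ineq[of "?u - ?L n (\<theta>, 0)" "?L n (\<theta>, 0)"] by simp
        also have "\<dots> \<le> e / 3 + e / 3"
          using elim L_small[of "(\<theta>, 0)"] by (intro add_mono) (force intro: less_imp_le)+
        finally show "dist (slice W y \<theta>) (apply_bcontfun 0 \<theta>) \<le> 2 * (e / 3)"
          by (simp add: dist_norm)
      qed
      with \<open>e > 0\<close> show ?case by simp
    qed
  qed

  have "P t W (\<theta>, x) = W (\<theta>, x - c * t)" if "t \<ge> 0" for t \<theta> x
  proof -
    have "shift (c * t) (Q t W) = P t W" by (simp add: Q_def)
    then have "P t W = shift (c * t) W" using fixed[OF that] by simp
    then show ?thesis by simp
  qed
  moreover have "\<exists>p q. W p \<noteq> W q"
  proof (rule ccontr)
    assume "\<nexists>p q. W p \<noteq> W q"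
    then have "slice W = (\<lambda>y. slice W 0)"
      by (intro ext bcontfun_eqI) auto
    then have "slice W 0 = 0" "slice W 0 = rs"
      using at_bot at_top by (metis tendsto_const_iff trivial_limit_at_bot_linorder trivial_limit_at_top_linorder)+
    then show False using rs by (auto simp: IntYplus_def int_orthant_iff)
  qed
  ultimately have "travelling_wave P c rs W"
    using W at_top at_bot by (simp add: travelling_wave_def)
  then show ?thesis ..
qed

end
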